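(* Let $m\ge2$, let $\Omega\subset\mathbb{R}^m$ be open and let $f=(f^1,\dots,f^{2n+1})\in W^{1,1}_{\mathrm{loc}}(\Omega,\mathbb{R}^{2n+1})$. If $$df^{2n+1}=\sum_{j=1}^n\big(f^j\,df^{j+n}-f^{j+n}\,df^j\big)\quad\text{a.e. in }\Omega,$$ then almost everywhere in $\Omega$ we have $\sum_{j=1}^n df^j\wedge df^{j+n}=0$, i.e. for all $1\le k<l\le m$, $$\sum_{j=1}^n\Big(\frac{\partial f^j}{\partial x_k}\frac{\partial f^{j+n}}{\partial x_l}-\frac{\partial f^j}{\partial x_l}\frac{\partial f^{j+n}}{\partial x_k}\Big)=0\quad\text{a.e. in }\Omega.$$
   Context: All differentials and partial derivatives are weak (Sobolev) derivatives, defined almost everywhere. *)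

theory Defs
  imports "HOL-Analysis.Analysis"
begin

definition pd :: "'m::finite \<Rightarrow> (real^'m \<Rightarrow> real) \<Rightarrow> real^'m \<Rightarrow> real" where
  "pd k g x = frechet_derivative g (at x) (axis k 1)"

fun iter_pd :: "'m::finite list \<Rightarrow> (real^'m \<Rightarrow> real) \<Rightarrow> real^'m \<Rightarrow> real" where
  "iter_pd [] g = g"
| "iter_pd (k # ks) g = pd k (iter_pd ks g)"

definition smooth_fun :: "(real^'m::finite \<Rightarrow> real) \<Rightarrow> bool" where
  "smooth_fun g \<longleftrightarrow> (\<forall>ks. (\<forall>x. iter_pd ks g differentiable (at x)) \<and> continuous_on UNIV (iter_pd ks g))"

definition test_fun :: "(real^'m::finite) set \<Rightarrow> (real^'m \<Rightarrow> real) \<Rightarrow> bool" where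
  "test_fun \<Omega> \<phi> \<longleftrightarrow> smooth_fun \<phi> \<and> compact (closure {x. \<phi> x \<noteq> 0}) \<and> closure {x. \<phi> x \<noteq> 0} \<subseteq> \<Omega>"

definition L1_loc :: "(real^'m::finite) set \<Rightarrow> (real^'m \<Rightarrow> real) \<Rightarrow> bool" where
  "L1_loc \<Omega> u \<longleftrightarrow> (\<forall>K. compact K \<and> K \<subseteq> \<Omega> \<longrightarrow> u absolutely_integrable_on K)"

definition weak_partial :: "(real^'m::finite) set \<Rightarrow> (real^'m \<Rightarrow> real) \<Rightarrow> 'm \<Rightarrow> (real^'m \<Rightarrow> real) \<Rightarrow> bool" where
  "weak_partial \<Omega> u k g \<longleftrightarrow> L1_loc \<Omega> u \<and> L1_loc \<Omega> g \<and>
     (\<forall>\<phi>. test_fun \<Omega> \<phi> \<longrightarrow>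
        integral \<Omega> (\<lambda>x. u x * pd k \<phi> x) = - integral \<Omega> (\<lambda>x. g x * \<phi> x))"

definition W11_loc :: "(real^'m::finite) set \<Rightarrow> (real^'m \<Rightarrow> real) \<Rightarrow> bool" where
  "W11_loc \<Omega> u \<longleftrightarrow> L1_loc \<Omega> u \<and> (\<forall>k. \<exists>g. weak_partial \<Omega> u k g)"

end

theory Submission
  imports Defs
begin

text \<open>
  Write \<open>z = (f\<^sup>1, \<dots>, f\<^sup>2\<^sup>n)\<close> and let \<open>\<omega>\<close> be the standard symplectic form, so that the
  contact equation reads \<open>df\<^sup>2\<^sup>n\<^sup>+\<^sup>1 = \<omega>(z, dz)\<close>. Along almost every axis-parallel segment, the increment
  of a Sobolev function is the integral of its weak derivative. Hence for fixed \<open>h\<close> and almost every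
  \<open>x\<close>, the integral of \<open>\<omega>(z, dz)\<close> around the square with corner \<open>x\<close> and sides \<open>h e\<^sub>k\<close>, \<open>h e\<^sub>l\<close>
  vanishes, because \<open>f\<^sup>2\<^sup>n\<^sup>+\<^sup>1\<close> returns to its initial value. By continuity of translations in \<open>L\<^sup>1\<close>,
  there is a sequence \<open>h \<rightarrow> 0\<close> along which, for almost every \<open>x\<close>, the means of \<open>\<partial>\<^sub>kz\<close> and \<open>\<partial>\<^sub>lz\<close>
  over the sides of the square converge to their values at \<open>x\<close>. The loop integral divided by \<open>h\<^sup>2\<close>
  then tends to \<open>2 \<omega>(\<partial>\<^sub>kz, \<partial>\<^sub>lz)(x)\<close>, which is therefore zero.

  No slicing of the space is needed: a statement about almost every segment is
  Fubini's theorem for the pair \<open>(x, s)\<close> and the points \<open>x + s e\<^sub>k\<close>.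
\<close>

section \<open>Translations in \<open>L\<^sup>1\<close>\<close>

text \<open>The obvious route, taking the exterior derivative of the contact equation, is closed:
  for \<open>W11_loc\<close> functions neither the single products of a component with a derivative
  nor the products of two derivatives need be locally integrable, and mollification does not
  preserve a nonlinear equation. On a segment, however, the components are indefinite integrals,
  hence bounded, and their products with derivatives are integrable there. Expand \<open>z\<close>
  around \<open>x\<close>. The terms linear in \<open>z(x)\<close> have size \<open>h\<close> only,
  too large for a division by \<open>h^2\<close>, but they cancel exactly because \<open>z\<close>
  also returns to its initial value. Along a single side the remaining quadratic term is twice a
  Levy area, which is \<open>o(h^2)\<close> because the derivative is nearly constant in mean. What
  survives are the cross terms of the two ways round the square: with \<open>p\<close>,
  \<open>q\<close> the limits of the mean derivatives in the two directions, one way gives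
  \<open>\<omega>(p, q)\<close> and the other \<open>\<omega>(q, p)\<close>. Their difference is the
  factor 2. The sides away from \<open>x\<close> move with \<open>h\<close>, so Lebesgue points on a
  fixed line would not control them; convergence in \<open>L^1\<close> does, at the price of a
  subsequence.\<close>

lemma integrable_lborel_translate:
  fixes f :: "'a::euclidean_space \<Rightarrow> 'b::{banach, second_countable_topology}"
  assumes "integrable lborel f"
  shows "integrable lborel (\<lambda>x. f (x + v))"
proof -
  have "integrable (distr lborel borel ((+) v)) f"
    using assms by (simp add: lborel_distr_plus)
  then have "integrable lborel (\<lambda>x. f (v + x))"
    by (rule integrable_distr[rotated]) simp
  then show ?thesis by (simp add: add.commute)
qed

lemma integral_lborel_translate:
  fixes f :: "'a::euclidean_space \<Rightarrow> 'b::{banach, second_countable_topology}"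
  assumes [measurable]: "f \<in> borel_measurable borel"
  shows "(\<integral>x. f (x + v) \<partial>lborel) = (\<integral>x. f x \<partial>lborel)"
proof -
  have "(\<integral>x. f x \<partial>lborel) = (\<integral>x. f x \<partial>distr lborel borel ((+) v))"
    by (simp add: lborel_distr_plus)
  also have "\<dots> = (\<integral>x. f (v + x) \<partial>lborel)"
    by (rule integral_distr) auto
  finally show ?thesis by (simp add: add.commute)
qed

lemma AE_lborel_translate:
  fixes v :: "'a::euclidean_space"
  assumes "AE x in lborel. P x"
  shows "AE x in lborel. P (x + v)"
proof -
  have "AE x in distr lborel borel ((+) v). P x"
    using assms unfolding lborel_distr_plus .
  then have "AE x in lborel. P (v + x)"
    by (rule AE_distrD[rotated]) simp
  then show ?thesis by (simp add: add.commute)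
qed

text \<open>Approximation by simple functions: the set of good \<open>f\<close> is closed under sums
  and dominated limits, because translation preserves the \<open>L^1\<close> norm. For an indicator,
  outer regularity passes to an open set, whose points stay inside under small shifts.\<close>

lemma translation_continuous_L1:
  fixes f :: "'a::euclidean_space \<Rightarrow> real"
  assumes "integrable lborel f" and v: "v \<longlonglongrightarrow> 0"
  shows "(\<lambda>n::nat. \<integral>x. \<bar>f (x + v n) - f x\<bar> \<partial>lborel) \<longlonglongrightarrow> 0"
  using assms(1)
proof (induction rule: integrable_induct)
  case (base A c)
  have A: "A \<in> sets borel" "emeasure lborel A < \<infinity>"
    using base by auto
  let ?I = "\<lambda>S x. indicator S x :: real"
  have main: "(\<lambda>n. \<integral>x. \<bar>?I A (x + v n) - ?I A x\<bar> \<partial>lborel) \<longlonglongrightarrow> 0"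
  proof (rule LIMSEQ_I)
    fix e :: real assume e: "e > 0"
    obtain T where T: "open T" "A \<subseteq> T" "emeasure lebesgue (T - A) < ennreal (e/4)"
      using sets_lebesgue_outer_open[of A "e/4"] A e by auto
    have Tm[measurable]: "T \<in> sets borel" using T by auto
    have Am[measurable]: "A \<in> sets borel" using A by auto
    have eTA: "emeasure lborel (T - A) < ennreal (e/4)"
      using T(3) by simp
    have eT: "emeasure lborel T < \<infinity>"
    proof -
      have "emeasure lborel T \<le> emeasure lborel (T - A) + emeasure lborel A"
        by (rule order.trans[OF _ emeasure_subadditive]) (auto intro!: emeasure_mono)
      also have "\<dots> < \<infinity>" using eTA A(2) by (auto simp: less_top[symmetric])
      finally show ?thesis .
    qed
    have iT: "integrable lborel (?I T)" and iA: "integrable lborel (?I A)"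
      and iTA: "integrable lborel (?I (T - A))"
      using eT A eTA by (auto simp: integrable_indicator_iff less_top[symmetric])
    have mTA: "(\<integral>x. ?I (T - A) x \<partial>lborel) < e/4"
    proof -
      have "emeasure lborel (T - A) = ennreal (measure lborel (T - A))"
        using eTA by (intro emeasure_eq_ennreal_measure) auto
      then have "measure lborel (T - A) < e/4"
        using eTA e by (simp add: ennreal_less_iff)
      then show ?thesis by simp
    qed
    note tr = integrable_lborel_translate
    \<comment> \<open>Openness of \<open>T\<close> controls only the points that leave
      \<open>T\<close>: a point outside may be moved in at every stage. Hence only the loss is shown
      to tend to zero, dominated by the indicator of \<open>T\<close>; the gain is recovered below
      from invariance of the integral.\<close>
    have pos: "(\<lambda>n. \<integral>x. max 0 (?I T x - ?I T (x + v n)) \<partial>lborel) \<longlonglongrightarrow> integral\<^sup>L lborel (\<lambda>x::'a. 0::real)"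
    proof (rule integral_dominated_convergence[where w = "?I T"])
      show "AE x in lborel. (\<lambda>n. max 0 (?I T x - ?I T (x + v n))) \<longlonglongrightarrow> 0"
      proof (rule AE_I2)
        fix x :: 'a
        show "(\<lambda>n. max 0 (?I T x - ?I T (x + v n))) \<longlonglongrightarrow> 0"
        proof (cases "x \<in> T")
          case True
          have "(\<lambda>n. x + v n) \<longlonglongrightarrow> x" using v by (auto intro: tendsto_eq_intros)
          then have "\<forall>\<^sub>F n in sequentially. x + v n \<in> T"
            using T(1) True by (rule topological_tendstoD)
          then have "\<forall>\<^sub>F n in sequentially. max 0 (?I T x - ?I T (x + v n)) = 0"
            by eventually_elim (use True in auto)
          then show ?thesis by (rule tendsto_eventually)
        qed (simp add: indicator_def)
      qed
      show "\<And>n. AE x in lborel. norm (max 0 (?I T x - ?I T (x + v n))) \<le> ?I T x"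
        by (intro AE_I2) (auto simp: indicator_def)
    qed (use iT in auto)
    then obtain N where N: "\<And>n. n \<ge> N \<Longrightarrow> (\<integral>x. max 0 (?I T x - ?I T (x + v n)) \<partial>lborel) < e/4"
      using order_tendstoD(2)[OF pos, of "e/4"] e by (auto simp: eventually_sequentially)
    have "norm ((\<integral>x. \<bar>?I A (x + v n) - ?I A x\<bar> \<partial>lborel) - 0) < e" if n: "n \<ge> N" for n
    proof -
      let ?p = "\<lambda>x. max 0 (?I T x - ?I T (x + v n))"
      have ip: "integrable lborel ?p"
        using iT tr[OF iT] by (intro integrable_max) auto
      \<comment> \<open>With \<open>d = ?I T (x + v n) - ?I T x\<close>, the last two summands are
        \<open>2 * max 0 (- d) + d = \<bar>d\<bar>\<close>, and \<open>d\<close> has integral zero.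
        So the total is twice the measure of \<open>T - A\<close> plus twice the loss, each factor
        below \<open>e/4\<close>.\<close>
      have "(\<integral>x. \<bar>?I A (x + v n) - ?I A x\<bar> \<partial>lborel)
          \<le> (\<integral>x. ?I (T - A) (x + v n) + ?I (T - A) x + 2 * ?p x
               + (?I T (x + v n) - ?I T x) \<partial>lborel)"
        using T(2)
        by (intro integral_mono Bochner_Integration.integrable_add Bochner_Integration.integrable_diff iT iTA ip tr iA
            integrable_abs integrable_mult_right) (auto simp: indicator_def)
      also have "\<dots> = (\<integral>x. ?I (T - A) (x + v n) \<partial>lborel) + (\<integral>x. ?I (T - A) x \<partial>lborel)
          + 2 * (\<integral>x. ?p x \<partial>lborel) + ((\<integral>x. ?I T (x + v n) \<partial>lborel) - (\<integral>x. ?I T x \<partial>lborel))"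
      proof -
        note i = tr[OF iTA, of "v n"] iTA ip tr[OF iT, of "v n"] iT
        show ?thesis
          by (simp only: Bochner_Integration.integral_add Bochner_Integration.integral_diff
             integral_mult_right_zero Bochner_Integration.integrable_add
             Bochner_Integration.integrable_diff integrable_mult_right i)
      qed
      also have "\<dots> = 2 * (\<integral>x. ?I (T - A) x \<partial>lborel) + 2 * (\<integral>x. ?p x \<partial>lborel)"
        using integral_lborel_translate[of "?I (T - A)" "v n"] integral_lborel_translate[of "?I T" "v n"]
        by simp
      also have "\<dots> < e" using mTA N[OF n] by linarith
      finally show ?thesis by simp
    qed
    then show "\<exists>no. \<forall>n\<ge>no. norm ((\<integral>x. \<bar>?I A (x + v n) - ?I A x\<bar> \<partial>lborel) - 0) < e" by blast
  qed
  have "\<bar>?I A (x + v n) *\<^sub>R c - ?I A x *\<^sub>R c\<bar> = \<bar>c\<bar> * \<bar>?I A (x + v n) - ?I A x\<bar>" for x n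
    by (simp add: left_diff_distrib[symmetric] abs_mult)
  then show ?case
    using tendsto_mult[OF tendsto_const main, of "\<bar>c\<bar>"] by simp
next
  case (add f g)
  note i = add(1,2) and tr = integrable_lborel_translate
  have "(\<lambda>n. (\<integral>x. \<bar>f (x + v n) - f x\<bar> \<partial>lborel) + (\<integral>x. \<bar>g (x + v n) - g x\<bar> \<partial>lborel)) \<longlonglongrightarrow> 0"
    using tendsto_add[OF add(3,4)] by simp
  then show ?case
  proof (rule tendsto_sandwich[OF _ _ tendsto_const, rotated 2], goal_cases)
    case 1 then show ?case by simp
  next
    case 2
    show ?case
    proof (intro always_eventually allI)
      fix n
      have "(\<integral>x. \<bar>f (x + v n) + g (x + v n) - (f x + g x)\<bar> \<partial>lborel)
        \<le> (\<integral>x. \<bar>f (x + v n) - f x\<bar> + \<bar>g (x + v n) - g x\<bar> \<partial>lborel)"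
        by (intro integral_mono integrable_abs Bochner_Integration.integrable_add
            Bochner_Integration.integrable_diff i tr) auto
      also have "\<dots> = (\<integral>x. \<bar>f (x + v n) - f x\<bar> \<partial>lborel) + (\<integral>x. \<bar>g (x + v n) - g x\<bar> \<partial>lborel)"
        by (intro Bochner_Integration.integral_add integrable_abs
            Bochner_Integration.integrable_diff i tr)
      finally show "(\<integral>x. \<bar>f (x + v n) + g (x + v n) - (f x + g x)\<bar> \<partial>lborel)
        \<le> (\<integral>x. \<bar>f (x + v n) - f x\<bar> \<partial>lborel) + (\<integral>x. \<bar>g (x + v n) - g x\<bar> \<partial>lborel)" .
    qed
  qed
next
  case (lim f s)
  note tr = integrable_lborel_translate
  have s: "\<And>i. integrable lborel (s i)" and f: "integrable lborel f"
    using lim by auto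
  have [measurable]: "\<And>i. s i \<in> borel_measurable borel" "f \<in> borel_measurable borel"
    using borel_measurable_integrable[OF s] borel_measurable_integrable[OF f] by auto
  \<comment> \<open>The approximating functions of the induction rule satisfy
    \<open>norm (s i x) \<le> 2 * norm (f x)\<close>, whence the dominating function
    \<open>3 * \<bar>f x\<bar>\<close>.\<close>
  have "(\<lambda>i. \<integral>x. \<bar>s i x - f x\<bar> \<partial>lborel) \<longlonglongrightarrow> integral\<^sup>L lborel (\<lambda>x::'a. 0::real)"
  proof (rule integral_dominated_convergence[where w = "\<lambda>x. 3 * \<bar>f x\<bar>"])
    show "AE x in lborel. (\<lambda>i. \<bar>s i x - f x\<bar>) \<longlonglongrightarrow> 0"
    proof (rule AE_I2)
      fix x
      have "(\<lambda>i. s i x) \<longlonglongrightarrow> f x" using lim by auto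
      then show "(\<lambda>i. \<bar>s i x - f x\<bar>) \<longlonglongrightarrow> 0" by (simp add: LIM_zero tendsto_rabs_zero)
    qed
    show "AE x in lborel. norm \<bar>s i x - f x\<bar> \<le> 3 * \<bar>f x\<bar>" for i
    proof (rule AE_I2)
      fix x
      have "norm (s i x) \<le> 2 * norm (f x)" using lim by auto
      then show "norm \<bar>s i x - f x\<bar> \<le> 3 * \<bar>f x\<bar>" by simp
    qed
  qed (use f in auto)
  then have L: "(\<lambda>i. \<integral>x. \<bar>s i x - f x\<bar> \<partial>lborel) \<longlonglongrightarrow> 0" by simp
  show ?case
  proof (rule LIMSEQ_I)
    fix e :: real assume e: "e > 0"
    obtain i where i: "(\<integral>x. \<bar>s i x - f x\<bar> \<partial>lborel) < e/3"
      using order_tendstoD(2)[OF L, of "e/3"] e by (auto simp: eventually_sequentially)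
    obtain N where N: "\<And>n. n \<ge> N \<Longrightarrow> (\<integral>x. \<bar>s i (x + v n) - s i x\<bar> \<partial>lborel) < e/3"
      using order_tendstoD(2)[OF lim.IH[of i], of "e/3"] e by (auto simp: eventually_sequentially)
    have "norm ((\<integral>x. \<bar>f (x + v n) - f x\<bar> \<partial>lborel) - 0) < e" if n: "n \<ge> N" for n
    proof -
      have i1: "integrable lborel (\<lambda>x. \<bar>s i x - f x\<bar>)" using s f by auto
      have i2: "integrable lborel (\<lambda>x. \<bar>s i (x + v n) - s i x\<bar>)" using s tr[OF s] by auto
      have i3: "integrable lborel (\<lambda>x. \<bar>s i (x + v n) - f (x + v n)\<bar>)"
        using tr[OF i1, of "v n"] .
      have "(\<integral>x. \<bar>f (x + v n) - f x\<bar> \<partial>lborel)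
        \<le> (\<integral>x. \<bar>s i (x + v n) - f (x + v n)\<bar> + \<bar>s i (x + v n) - s i x\<bar> + \<bar>s i x - f x\<bar> \<partial>lborel)"
        using tr[OF f] f
        by (intro integral_mono Bochner_Integration.integrable_add i1 i2 i3) auto
      also have "\<dots> = (\<integral>x. \<bar>s i (x + v n) - f (x + v n)\<bar> \<partial>lborel)
          + (\<integral>x. \<bar>s i (x + v n) - s i x\<bar> \<partial>lborel) + (\<integral>x. \<bar>s i x - f x\<bar> \<partial>lborel)"
        by (simp only: Bochner_Integration.integral_add Bochner_Integration.integrable_add i1 i2 i3)
      also have "(\<integral>x. \<bar>s i (x + v n) - f (x + v n)\<bar> \<partial>lborel) = (\<integral>x. \<bar>s i x - f x\<bar> \<partial>lborel)"
        by (rule integral_lborel_translate[of "\<lambda>x. \<bar>s i x - f x\<bar>"]) simp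
      also have "(\<integral>x. \<bar>s i x - f x\<bar> \<partial>lborel) + (\<integral>x. \<bar>s i (x + v n) - s i x\<bar> \<partial>lborel)
          + (\<integral>x. \<bar>s i x - f x\<bar> \<partial>lborel) < e"
        using i N[OF n] by linarith
      finally show ?thesis by simp
    qed
    then show "\<exists>no. \<forall>n\<ge>no. norm ((\<integral>x. \<bar>f (x + v n) - f x\<bar> \<partial>lborel) - 0) < e" by blast
  qed
qed

section \<open>Smooth bumps on boxes\<close>

text \<open>
  The bump \<open>exp (-c / ((t - a) (b - t)))\<close> on \<open>(a, b)\<close> and all its derivatives have this form;
  as \<open>c\<close> tends to \<open>0\<close> the bumps converge to the indicator of \<open>(a, b)\<close>.
\<close>
definition bump_deriv :: "real \<Rightarrow> real \<Rightarrow> real \<Rightarrow> real poly \<Rightarrow> nat \<Rightarrow> real \<Rightarrow> real" where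
  "bump_deriv c a b P k t = (if a < t \<and> t < b
     then poly P t * (1 / ((t - a) * (b - t))) ^ k * exp (- c / ((t - a) * (b - t))) else 0)"

text \<open>A single term of the exponential series of \<open>c * q\<close> is at most the whole
  series.\<close>

lemma power_exp_neg_bounded:
  fixes c q :: real
  assumes "c > 0" "q \<ge> 0"
  shows "q ^ n * exp (- c * q) \<le> fact n / c ^ n"
proof -
  have "(c * q) ^ n /\<^sub>R fact n \<le> exp (c * q)"
    unfolding exp_def
    by (rule order.trans[OF _ sum_le_suminf[OF summable_exp_generic, of "{n}"]])
       (use assms in auto)
  then show ?thesis
    using assms by (simp add: exp_minus field_simps power_mult_distrib)
qed

text \<open>The exponential absorbs any power of \<open>1/R\<close>, where
  \<open>R = (y - a) * (b - y)\<close>. Two powers more than \<open>k\<close> are absorbed, which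
  leaves \<open>R^2\<close>: quadratic vanishing at the endpoints is what forces the derivative
  there to be zero.\<close>

lemma bump_deriv_le:
  assumes "c > 0"
  obtains M where "M \<ge> 0" "\<And>y. \<bar>bump_deriv c a b P k y\<bar> \<le> M * ((y - a) * (b - y))\<^sup>2"
proof -
  have "compact (poly P ` {a..b})"
    by (intro compact_continuous_image continuous_intros) auto
  then obtain B where B: "B > 0" "\<And>y. y \<in> {a..b} \<Longrightarrow> \<bar>poly P y\<bar> \<le> B"
    by (metis bounded_pos compact_imp_bounded image_eqI real_norm_def)
  define M where "M = B * (fact (k+2) / c ^ (k+2))"
  have "\<bar>bump_deriv c a b P k y\<bar> \<le> M * ((y - a) * (b - y))\<^sup>2" for y
  proof (cases "a < y \<and> y < b")
    case True
    define R where "R = (y - a) * (b - y)"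
    have R: "R > 0" using True by (simp add: R_def)
    have "(1/R) ^ k * exp (- c / R) = R\<^sup>2 * ((1/R) ^ (k+2) * exp (- c * (1/R)))"
      using R by (simp add: field_simps power2_eq_square)
    also have "\<dots> \<le> R\<^sup>2 * (fact (k+2) / c ^ (k+2))"
      using power_exp_neg_bounded[OF assms, of "1/R" "k+2"] R by (intro mult_left_mono) auto
    finally have 1: "(1/R) ^ k * exp (- c / R) \<le> R\<^sup>2 * (fact (k+2) / c ^ (k+2))" .
    have "\<bar>bump_deriv c a b P k y\<bar> = \<bar>poly P y\<bar> * ((1/R) ^ k * exp (- c / R))"
      using True R unfolding bump_deriv_def R_def[symmetric] by (simp add: abs_mult)
    also have "\<dots> \<le> B * (R\<^sup>2 * (fact (k+2) / c ^ (k+2)))"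
      by (rule mult_mono) (use B True R 1 in auto)
    finally show ?thesis by (simp add: M_def R_def mult_ac)
  qed (use B assms in \<open>auto simp: bump_deriv_def M_def\<close>)
  moreover have "M \<ge> 0" using B assms by (simp add: M_def)
  ultimately show ?thesis using that by blast
qed

lemma DERIV_zero_if_quadratic_bound:
  fixes f :: "real \<Rightarrow> real"
  assumes "\<And>y. \<bar>f y\<bar> \<le> C * (y - t)\<^sup>2"
  shows "(f has_real_derivative 0) (at t)"
proof -
  have "f t = 0" using assms[of t] by simp
  have "((\<lambda>y. C * (y - t)) \<longlongrightarrow> C * (t - t)) (at t)"
    by (intro tendsto_intros)
  then have lim: "((\<lambda>y. \<bar>C * (y - t)\<bar>) \<longlongrightarrow> 0) (at t)"
    by (simp add: tendsto_rabs_zero)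
  have "((\<lambda>y. (f y - f t) / (y - t)) \<longlongrightarrow> 0) (at t)"
  proof (rule Lim_null_comparison[OF _ lim])
    show "\<forall>\<^sub>F y in at t. norm ((f y - f t) / (y - t)) \<le> \<bar>C * (y - t)\<bar>"
      unfolding eventually_at_filter
    proof (rule always_eventually, intro allI impI)
      fix y assume "y \<noteq> t"
      then have "\<bar>y - t\<bar> > 0" by simp
      have "\<bar>f y\<bar> \<le> \<bar>C\<bar> * \<bar>y - t\<bar> * \<bar>y - t\<bar>"
        using assms[of y] mult_right_mono[OF abs_ge_self[of C], of "(y-t)\<^sup>2"]
        by (simp add: power2_eq_square mult.assoc abs_mult[symmetric])
      then show "norm ((f y - f t) / (y - t)) \<le> \<bar>C * (y - t)\<bar>"
        using \<open>\<bar>y - t\<bar> > 0\<close> \<open>f t = 0\<close> by (simp add: divide_le_eq abs_mult)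
    qed
  qed
  then show ?thesis by (simp add: has_field_derivative_iff)
qed

text \<open>The numerator that results when the derivative of
  \<open>P * (1/R)^k * exp (- c / R)\<close> is brought to the common factor
  \<open>(1/R)^(k+2)\<close>. Its three terms come from differentiating \<open>P\<close>, the power
  and the exponential.\<close>

definition bump_step :: "real \<Rightarrow> real \<Rightarrow> real \<Rightarrow> real poly \<Rightarrow> nat \<Rightarrow> real poly" where
  "bump_step c a b P k = (let R = [:-a, 1:] * [:b, -1:]; R' = [:a + b, -2:] in
     pderiv P * R\<^sup>2 - smult (real k) (P * R' * R) + smult c (P * R'))"

text \<open>Inside the interval this is the product rule with the numerator
  \<open>bump_step\<close>. At the endpoints and beyond them a quadratic bound around
  \<open>t\<close> gives the derivative 0, so that the two regimes fit together smoothly.\<close>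

lemma DERIV_bump_deriv:
  assumes c: "c > 0"
  shows "(bump_deriv c a b P k has_real_derivative
    bump_deriv c a b (bump_step c a b P k) (k + 2) t) (at t)"
proof (cases "a < t \<and> t < b")
  case True
  let ?R = "\<lambda>t. (t - a) * (b - t)"
  have R: "?R t > 0" using True by simp
  have e: "((\<lambda>t. poly P t * (1 / ?R t) ^ k * exp (- c / ?R t)) has_real_derivative
     bump_deriv c a b (bump_step c a b P k) (k + 2) t) (at t)"
  proof -
    define Q where "Q = ?R t"
    define Q' where "Q' = a + b - 2 * t"
    have Q: "Q > 0" using R by (simp add: Q_def)
    have dR: "(?R has_real_derivative Q') (at t)"
      unfolding Q'_def by (auto intro!: derivative_eq_intros)
    have dq: "((\<lambda>t. 1 / ?R t) has_real_derivative (- Q' / Q\<^sup>2)) (at t)"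
    proof -
      have "?R t \<noteq> 0" using True by simp
      from DERIV_inverse'[OF dR this] show ?thesis
        by (simp add: Q_def power2_eq_square divide_inverse mult_ac)
    qed
    have dk: "((\<lambda>t. (1 / ?R t) ^ k) has_real_derivative (- real k * Q' * (1/Q) ^ (k+1))) (at t)"
    proof (rule DERIV_cong[OF DERIV_power[OF dq, of k]], unfold Q_def[symmetric])
      show "of_nat k * (- Q' / Q\<^sup>2 * (1 / Q) ^ (k - Suc 0)) = - real k * Q' * (1 / Q) ^ (k + 1)"
        using Q by (cases k) (simp_all add: power2_eq_square divide_inverse algebra_simps)
    qed
    have de: "((\<lambda>t. exp (- c / ?R t)) has_real_derivative (exp (- c / Q) * (c * Q' / Q\<^sup>2))) (at t)"
    proof -
      have f: "(\<lambda>t. exp (- c / ?R t)) = (\<lambda>t. exp (- c * (1 / ?R t)))"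
        by (simp only: times_divide_eq_right mult_1_right)
      show ?thesis
        unfolding f
        by (rule DERIV_cong[OF DERIV_fun_exp[OF DERIV_cmult[OF dq]]], unfold Q_def[symmetric]) simp
    qed
    have pR: "poly ([:-a, 1:] * [:b, -1:]) t = Q" "poly [:a + b, -2:] t = Q'"
      by (simp_all add: Q_def Q'_def algebra_simps)
    have eq: "bump_deriv c a b (bump_step c a b P k) (k + 2) t =
       (poly (pderiv P) t * Q\<^sup>2 - real k * (poly P t * Q' * Q) + c * (poly P t * Q')) *
        (1/Q) ^ (k+2) * exp (- c / Q)"
      using True unfolding bump_deriv_def bump_step_def Let_def poly_add poly_diff poly_smult
        poly_mult[of _ "[:a + b, - 2:]"] poly_mult[of _ "[:- a, 1:] * [:b, - 1:]"] poly_mult[of "pderiv P"] poly_power pR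
      by (simp add: Q_def)
    show ?thesis
      unfolding eq
    proof (rule DERIV_cong[OF DERIV_mult[OF DERIV_mult[OF poly_DERIV dk] de]], unfold Q_def[symmetric])
      define w where "w = 1 / Q"
      define E where "E = exp (- c / Q)"
      have w: "Q * w = 1" "c * Q' / Q\<^sup>2 = c * Q' * w * w"
        using Q by (simp_all add: w_def power2_eq_square)
      have *: "w ^ k * w * w * Q = w ^ k * w" "w ^ k * w * Q = w ^ k"
        using w(1) by (simp_all add: mult.assoc mult.commute[of w Q])
      have "(poly (pderiv P) t * Q\<^sup>2 - real k * (poly P t * Q' * Q) + c * (poly P t * Q')) * w ^ (k+2) * E
        = (poly (pderiv P) t * ((w ^ k * w * w * Q) * Q) - real k * poly P t * Q' * (w ^ k * w * w * Q)
            + c * poly P t * Q' * (w ^ k * w * w)) * E"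
        by (simp add: power2_eq_square algebra_simps)
      also have "\<dots> = (poly (pderiv P) t * w ^ k + - real k * Q' * w ^ (k + 1) * poly P t) * E
          + E * (c * Q' * w * w) * (poly P t * w ^ k)"
        unfolding * by (simp add: algebra_simps)
      finally show "(poly (pderiv P) t * (1 / Q) ^ k + - real k * Q' * (1 / Q) ^ (k + 1) * poly P t) *
          exp (- c / Q) + exp (- c / Q) * (c * Q' / Q\<^sup>2) * (poly P t * (1 / Q) ^ k) =
        (poly (pderiv P) t * Q\<^sup>2 - real k * (poly P t * Q' * Q) + c * (poly P t * Q')) *
          (1 / Q) ^ (k + 2) * exp (- c / Q)"
        unfolding w(2) unfolding w_def[symmetric] E_def[symmetric] by simp
    qed
  qed
  show ?thesis
  proof (rule has_field_derivative_transform_within_open[OF e, of "{a<..<b}"])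
  qed (use True in \<open>auto simp: bump_deriv_def\<close>)
next
  case False
  obtain M where M: "M \<ge> 0" "\<And>y. \<bar>bump_deriv c a b P k y\<bar> \<le> M * ((y - a) * (b - y))\<^sup>2"
    using bump_deriv_le[OF c] by blast
  \<comment> \<open>As \<open>t\<close> lies at or beyond an endpoint, the distance of an interior
    \<open>y\<close> to that endpoint is at most \<open>\<bar>y - t\<bar>\<close>, and the other
    factor is at most \<open>b - a\<close>.\<close>
  have "\<bar>bump_deriv c a b P k y\<bar> \<le> (M * (b - a)\<^sup>2) * (y - t)\<^sup>2" for y
  proof (cases "a < y \<and> y < b")
    case True
    have "\<bar>(y - a) * (b - y)\<bar> \<le> \<bar>(b - a) * (y - t)\<bar>"
    proof (cases "t \<le> a")
      case True
      then have "(y - a) * (b - y) \<le> (y - t) * (b - a)"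
        using \<open>a < y \<and> y < b\<close> by (intro mult_mono) auto
      then show ?thesis using \<open>a < y \<and> y < b\<close> True by (simp add: abs_mult mult.commute)
    next
      case F: False
      then have "(y - a) * (b - y) \<le> (b - a) * (t - y)"
        using \<open>a < y \<and> y < b\<close> False by (intro mult_mono) auto
      then show ?thesis using \<open>a < y \<and> y < b\<close> False F by (simp add: abs_mult)
    qed
    then have "((y - a) * (b - y))\<^sup>2 \<le> ((b - a) * (y - t))\<^sup>2"
      by (rule power2_mono)
    then have "M * ((y - a) * (b - y))\<^sup>2 \<le> M * ((b - a) * (y - t))\<^sup>2"
      using M(1) by (rule mult_left_mono)
    then show ?thesis using M(2)[of y] by (simp add: power_mult_distrib mult.assoc)
  qed (use M in \<open>auto simp: bump_deriv_def\<close>)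
  then have "(bump_deriv c a b P k has_real_derivative 0) (at t)"
    by (rule DERIV_zero_if_quadratic_bound)
  moreover have "bump_deriv c a b (bump_step c a b P k) (k + 2) t = 0"
    unfolding bump_deriv_def by (rule if_not_P[OF False])
  ultimately show ?thesis by simp
qed

text \<open>By \<open>DERIV_bump_deriv\<close>,
  \<open>bump_deriv c a b (bump_poly c a b n) (2 * n)\<close> is the n-th derivative of the bump
  \<open>bump_deriv c a b 1 0\<close>; each differentiation raises the exponent by 2.\<close>

primrec bump_poly :: "real \<Rightarrow> real \<Rightarrow> real \<Rightarrow> nat \<Rightarrow> real poly" where
  "bump_poly c a b 0 = 1"
| "bump_poly c a b (Suc n) = bump_step c a b (bump_poly c a b n) (2 * n)"

text \<open>\<open>D i n\<close> stands for the n-th derivative of the i-th factor and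
  \<open>N\<close> is a multi-index. A partial derivative raises one entry of \<open>N\<close>, so
  these products are closed under \<open>pd\<close>, and smoothness in the sense of
  \<open>smooth_fun\<close> becomes an induction over the list of directions.\<close>

lemma pd_prod:
  fixes D :: "'m::finite \<Rightarrow> nat \<Rightarrow> real \<Rightarrow> real"
  assumes D: "\<And>i n t. (D i n has_real_derivative D i (Suc n) t) (at t)"
  shows "(\<lambda>x. \<Prod>i\<in>UNIV. D i (N i) (x $ i)) differentiable (at x)"
    and "pd k (\<lambda>x. \<Prod>i\<in>UNIV. D i (N i) (x $ i)) x = (\<Prod>i\<in>UNIV. D i ((N(k := Suc (N k))) i) (x $ i))"
proof -
  have d1: "((\<lambda>x. D i (N i) (x $ i)) has_derivative (\<lambda>y. D i (Suc (N i)) (x $ i) * y $ i)) (at x)" for i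
  proof -
    have "(D i (N i) has_derivative (\<lambda>y. D i (Suc (N i)) (x $ i) * y)) (at (x $ i))"
      using D by (simp add: has_field_derivative_def)
    from has_derivative_compose[OF bounded_linear.has_derivative[OF bounded_linear_vec_nth has_derivative_ident] this]
    show ?thesis by simp
  qed
  have d: "((\<lambda>x. \<Prod>i\<in>UNIV. D i (N i) (x $ i)) has_derivative
     (\<lambda>y. \<Sum>i\<in>UNIV. D i (Suc (N i)) (x $ i) * y $ i * (\<Prod>j\<in>UNIV - {i}. D j (N j) (x $ j)))) (at x)"
    by (rule has_derivative_prod) (rule d1)
  then show "(\<lambda>x. \<Prod>i\<in>UNIV. D i (N i) (x $ i)) differentiable (at x)"
    by (rule differentiableI)
  have "pd k (\<lambda>x. \<Prod>i\<in>UNIV. D i (N i) (x $ i)) x =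
     (\<Sum>i\<in>UNIV. D i (Suc (N i)) (x $ i) * axis k 1 $ i * (\<Prod>j\<in>UNIV - {i}. D j (N j) (x $ j)))"
    unfolding pd_def frechet_derivative_at[OF d, symmetric] ..
  also have "\<dots> = (\<Sum>i\<in>UNIV. if i = k then D i (Suc (N i)) (x $ i) * (\<Prod>j\<in>UNIV - {i}. D j (N j) (x $ j)) else 0)"
    by (intro sum.cong) (auto simp: axis_def)
  also have "\<dots> = D k (Suc (N k)) (x $ k) * (\<Prod>j\<in>UNIV - {k}. D j (N j) (x $ j))"
    by simp
  also have "\<dots> = (\<Prod>i\<in>UNIV. D i ((N(k := Suc (N k))) i) (x $ i))"
    by (subst prod.remove[of UNIV k]) (auto intro!: prod.cong)
  finally show "pd k (\<lambda>x. \<Prod>i\<in>UNIV. D i (N i) (x $ i)) x = (\<Prod>i\<in>UNIV. D i ((N(k := Suc (N k))) i) (x $ i))" .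
qed

lemma smooth_fun_prod:
  fixes D :: "'m::finite \<Rightarrow> nat \<Rightarrow> real \<Rightarrow> real"
  assumes D: "\<And>i n t. (D i n has_real_derivative D i (Suc n) t) (at t)"
  shows "smooth_fun (\<lambda>x. \<Prod>i\<in>UNIV. D i 0 (x $ i))"
proof -
  have it: "\<exists>N. iter_pd ks (\<lambda>x. \<Prod>i\<in>UNIV. D i 0 (x $ i)) = (\<lambda>x. \<Prod>i\<in>UNIV. D i (N i) (x $ i))" for ks
  proof (induction ks)
    case Nil
    show ?case by (rule exI[of _ "\<lambda>_. 0"]) simp
  next
    case (Cons k ks)
    then obtain N where N: "iter_pd ks (\<lambda>x. \<Prod>i\<in>UNIV. D i 0 (x $ i)) = (\<lambda>x. \<Prod>i\<in>UNIV. D i (N i) (x $ i))"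
      by blast
    show ?case
      using pd_prod(2)[of D, OF D] by (intro exI[of _ "N(k := Suc (N k))"]) (simp add: N fun_eq_iff)
  qed
  show ?thesis
    unfolding smooth_fun_def
  proof (intro allI conjI)
    fix ks
    obtain N where N: "iter_pd ks (\<lambda>x. \<Prod>i\<in>UNIV. D i 0 (x $ i)) = (\<lambda>x. \<Prod>i\<in>UNIV. D i (N i) (x $ i))"
      using it by blast
    show d: "iter_pd ks (\<lambda>x. \<Prod>i\<in>UNIV. D i 0 (x $ i)) differentiable (at x)" for x
      unfolding N by (rule pd_prod(1)[of D, OF D])
    show "continuous_on UNIV (iter_pd ks (\<lambda>x. \<Prod>i\<in>UNIV. D i 0 (x $ i)))"
      using d by (intro continuous_at_imp_continuous_on ballI differentiable_imp_continuous_within) auto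
  qed
qed

definition box_bump :: "real \<Rightarrow> real^'m::finite \<Rightarrow> real^'m \<Rightarrow> real^'m \<Rightarrow> real" where
  "box_bump c a b x = (\<Prod>i\<in>UNIV. bump_deriv c (a $ i) (b $ i) 1 0 (x $ i))"

lemma box_bump_translate: "box_bump c (a + v) (b + v) x = box_bump c a b (x - v)"
  unfolding box_bump_def bump_deriv_def
  by (intro prod.cong refl) (auto simp: algebra_simps)

lemma box_bump_eq_0: "x \<notin> box a b \<Longrightarrow> box_bump c a b x = 0"
  by (auto simp: box_bump_def bump_deriv_def mem_box_cart)

lemma box_bump_bounds:
  assumes "c \<ge> 0"
  shows "0 \<le> box_bump c a b x" "box_bump c a b x \<le> 1"
  using assms by (auto simp: box_bump_def bump_deriv_def intro!: prod_nonneg prod_le_1)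

lemma box_bump_tendsto_indicator:
  fixes a b x :: "real^'m::finite"
  shows "(\<lambda>n. box_bump (1 / Suc n) a b x) \<longlonglongrightarrow> indicator (box a b) x"
proof (cases "x \<in> box a b")
  case True
  have "(\<lambda>n. bump_deriv (1 / Suc n) (a $ i) (b $ i) 1 0 (x $ i)) \<longlonglongrightarrow> 1" for i
  proof -
    have ab: "a $ i < x $ i" "x $ i < b $ i" using True by (auto simp: mem_box_cart)
    have "(\<lambda>n. exp (- (1 / real (Suc n)) / ((x $ i - a $ i) * (b $ i - x $ i)))) \<longlonglongrightarrow> exp (- 0 / ((x $ i - a $ i) * (b $ i - x $ i)))"
      using ab by (intro tendsto_intros LIMSEQ_Suc[OF lim_1_over_n]) auto
    then show ?thesis using ab by (simp add: bump_deriv_def)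
  qed
  then have "(\<lambda>n. box_bump (1 / Suc n) a b x) \<longlonglongrightarrow> (\<Prod>i\<in>(UNIV :: 'm set). 1)"
    unfolding box_bump_def by (rule tendsto_prod)
  then show ?thesis using True by simp
qed (simp add: box_bump_eq_0)

lemma test_fun_box_bump:
  assumes c: "c > 0" and "cbox a b \<subseteq> \<Omega>"
  shows "test_fun \<Omega> (box_bump c a b)"
proof -
  let ?D = "\<lambda>i n. bump_deriv c (a $ i) (b $ i) (bump_poly c (a $ i) (b $ i) n) (2 * n)"
  have "smooth_fun (\<lambda>x. \<Prod>i\<in>UNIV. ?D i 0 (x $ i))"
    using DERIV_bump_deriv[OF c] by (intro smooth_fun_prod[of ?D]) simp
  moreover have "(\<lambda>x. \<Prod>i\<in>UNIV. ?D i 0 (x $ i)) = box_bump c a b"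
    by (simp add: fun_eq_iff box_bump_def)
  ultimately have "smooth_fun (box_bump c a b)" by simp
  moreover have s: "closure {x. box_bump c a b x \<noteq> 0} \<subseteq> cbox a b"
    using box_bump_eq_0[of _ a b c] box_subset_cbox[of a b]
    by (intro closure_minimal closed_cbox) blast
  moreover have "compact (closure {x. box_bump c a b x \<noteq> 0})"
    using compact_Int_closed[OF compact_cbox closed_closure] s by (metis inf.absorb_iff2)
  ultimately show ?thesis
    using assms(2) unfolding test_fun_def by blast
qed

section \<open>Test functions and their translates\<close>

lemma test_fun_has_derivative:
  assumes "test_fun \<Omega> \<phi>"
  shows "(\<phi> has_derivative frechet_derivative \<phi> (at x)) (at x)"
proof -
  have "iter_pd [] \<phi> differentiable (at x)"
    using assms unfolding test_fun_def smooth_fun_def by blast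
  then show ?thesis by (simp add: frechet_derivative_works)
qed

lemma test_fun_continuous:
  assumes "test_fun \<Omega> \<phi>"
  shows "continuous_on UNIV \<phi>" "continuous_on UNIV (pd k \<phi>)"
proof -
  have *: "continuous_on UNIV (iter_pd ks \<phi>)" for ks
    using assms unfolding test_fun_def smooth_fun_def by blast
  show "continuous_on UNIV \<phi>" "continuous_on UNIV (pd k \<phi>)"
    using *[of "[]"] *[of "[k]"] by simp_all
qed

lemma test_fun_outside:
  assumes "test_fun \<Omega> \<phi>" "x \<notin> closure {x. \<phi> x \<noteq> 0}"
  shows "\<phi> x = 0" "pd k \<phi> x = 0"
proof -
  let ?S = "closure {x. \<phi> x \<noteq> 0}"
  have z: "\<phi> y = 0" if "y \<in> - ?S" for y
    using that closure_subset[of "{x. \<phi> x \<noteq> 0}"] by auto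
  show "\<phi> x = 0" using z[of x] assms(2) by simp
  have "(\<phi> has_derivative (\<lambda>_. 0)) (at x)"
  proof (rule has_derivative_transform_within_open[OF has_derivative_const])
    show "open (- ?S)" "x \<in> - ?S" using open_Compl[OF closed_closure] assms(2) by auto
    show "0 = \<phi> y" if "y \<in> - ?S" for y using z[OF that] by simp
  qed
  then show "pd k \<phi> x = 0"
    unfolding pd_def by (simp flip: frechet_derivative_at)
qed

lemma test_fun_bounded:
  assumes "test_fun \<Omega> \<phi>"
  obtains C where "C > 0" "\<And>x. \<bar>\<phi> x\<bar> \<le> C" "\<And>x. \<bar>pd k \<phi> x\<bar> \<le> C"
proof -
  let ?S = "closure {x. \<phi> x \<noteq> 0}"
  have S: "compact ?S" using assms by (auto simp: test_fun_def)
  have "bounded (\<phi> ` ?S)" "bounded (pd k \<phi> ` ?S)"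
    using test_fun_continuous[OF assms] S
    by (meson compact_continuous_image compact_imp_bounded continuous_on_subset top_greatest)+
  then obtain C1 C2 where C: "C1 > 0" "C2 > 0"
    "\<forall>y\<in>\<phi> ` ?S. norm y \<le> C1" "\<forall>y\<in>pd k \<phi> ` ?S. norm y \<le> C2"
    unfolding bounded_pos by blast
  have "\<bar>\<phi> x\<bar> \<le> C1 + C2" "\<bar>pd k \<phi> x\<bar> \<le> C1 + C2" for x
    using C(1,2) bspec[OF C(3), of "\<phi> x"] bspec[OF C(4), of "pd k \<phi> x"] test_fun_outside[OF assms, of x]
    by (cases "x \<in> ?S"; simp)+
  then show ?thesis using that[of "C1 + C2"] C by auto
qed

lemma pd_translate:
  assumes "test_fun \<Omega> \<phi>"
  shows "pd k (\<lambda>x. \<phi> (x - v)) x = pd k \<phi> (x - v)"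
proof -
  have "((\<lambda>x. \<phi> (x - v)) has_derivative frechet_derivative \<phi> (at (x - v))) (at x)"
    using has_derivative_compose[OF has_derivative_diff[OF has_derivative_ident has_derivative_const]
        test_fun_has_derivative[OF assms]] by simp
  then show ?thesis
    unfolding pd_def by (simp flip: frechet_derivative_at)
qed

text \<open>An increment of a Sobolev function, integrated against a test function, equals the
  function integrated against the backward increment of the test function. This is the fundamental
  theorem for that backward increment.\<close>

lemma test_fun_FTC:
  assumes "test_fun \<Omega> \<phi>" "h \<ge> 0"
  shows "\<phi> (x - h *\<^sub>R axis k 1) - \<phi> x = - (\<integral>s. indicator {0..h} s * pd k \<phi> (x - s *\<^sub>R axis k 1) \<partial>lborel)"
proof -
  have d: "((\<lambda>s. \<phi> (x - s *\<^sub>R axis k 1)) has_real_derivative - pd k \<phi> (x - s *\<^sub>R axis k 1)) (at s)" for s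
  proof -
    have lin: "linear (frechet_derivative \<phi> (at (x - s *\<^sub>R axis k 1)))"
      using test_fun_has_derivative[OF assms(1)] by (rule has_derivative_linear)
    have "((\<lambda>s. x - s *\<^sub>R axis k 1) has_derivative (\<lambda>y. - (y *\<^sub>R axis k 1))) (at s)"
      by (auto intro!: derivative_eq_intros)
    from has_derivative_compose[OF this test_fun_has_derivative[OF assms(1)]]
    show ?thesis
      unfolding has_field_derivative_def
      by (rule has_derivative_eq_rhs)
        (simp add: fun_eq_iff pd_def linear_neg[OF lin] linear_scale[OF lin])
  qed
  have "(\<integral>s. indicator {0..h} s *\<^sub>R (- pd k \<phi> (x - s *\<^sub>R axis k 1)) \<partial>lborel) =
     \<phi> (x - h *\<^sub>R axis k 1) - \<phi> (x - 0 *\<^sub>R axis k 1)"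
  proof (rule integral_FTC_atLeastAtMost[OF assms(2)])
    show "((\<lambda>s. \<phi> (x - s *\<^sub>R axis k 1)) has_vector_derivative - pd k \<phi> (x - s *\<^sub>R axis k 1)) (at s within {0..h})" for s
      using d[of s] by (auto simp: has_real_derivative_iff_has_vector_derivative intro: has_vector_derivative_at_within)
    show "continuous_on {0..h} (\<lambda>s. - pd k \<phi> (x - s *\<^sub>R axis k 1))"
      by (intro continuous_intros continuous_on_compose2[OF test_fun_continuous(2)[OF assms(1)]]) auto
  qed
  then show ?thesis by simp
qed

section \<open>Increments of Sobolev functions\<close>

lemma integrable_mult_bounded:
  fixes f g :: "'a \<Rightarrow> real"
  assumes f: "integrable M f" and g[measurable]: "g \<in> borel_measurable M" and b: "\<And>x. \<bar>g x\<bar> \<le> C"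
  shows "integrable M (\<lambda>x. f x * g x)"
proof (rule Bochner_Integration.integrable_bound[of M "\<lambda>x. C * \<bar>f x\<bar>"])
  show "integrable M (\<lambda>x. C * \<bar>f x\<bar>)" using f by simp
  show "(\<lambda>x. f x * g x) \<in> borel_measurable M"
    using borel_measurable_integrable[OF f] by measurable
  have "\<bar>f x * g x\<bar> \<le> \<bar>C * \<bar>f x\<bar>\<bar>" for x
  proof -
    have "\<bar>f x * g x\<bar> = \<bar>g x\<bar> * \<bar>f x\<bar>" by (simp add: abs_mult)
    also have "\<dots> \<le> C * \<bar>f x\<bar>" by (rule mult_right_mono[OF b]) simp
    finally show ?thesis by simp
  qed
  then show "AE x in M. norm (f x * g x) \<le> norm (C * \<bar>f x\<bar>)" by simp
qed

text \<open>Boxes are closed under intersection and generate the Borel sets, so the integral of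
  \<open>w\<close> over every Borel set vanishes. The complement step needs the total integral to be
  zero, which follows by exhausting the space with growing boxes.\<close>

lemma AE_zero_if_box_integrals_zero:
  fixes w :: "'a::euclidean_space \<Rightarrow> real"
  assumes w: "integrable lborel w"
    and z: "\<And>a b. (\<integral>x. indicator (box a b) x * w x \<partial>lborel) = 0"
  shows "AE x in lborel. w x = 0"
proof (rule density_unique_real[OF w])
  show "integrable lborel (\<lambda>x::'a. 0::real)" by simp
  have [measurable]: "w \<in> borel_measurable borel"
    using borel_measurable_integrable[OF w] by simp
  have si: "set_integrable lborel S w" if "S \<in> sets borel" for S
    unfolding set_integrable_def using w that by (intro integrable_mult_indicator) auto
  let ?B = "\<lambda>n::nat. box (- (real n *\<^sub>R One)) (real n *\<^sub>R One) :: 'a set"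
  have "(\<lambda>n. \<integral>x. indicator (?B n) x * w x \<partial>lborel) \<longlonglongrightarrow> (\<integral>x. w x \<partial>lborel)"
  proof (rule integral_dominated_convergence[where w = "\<lambda>x. \<bar>w x\<bar>"])
    show "AE x in lborel. (\<lambda>n. indicator (?B n) x * w x) \<longlonglongrightarrow> w x"
    proof (rule AE_I2)
      fix x :: 'a
      obtain N :: nat where N: "norm x < N" using reals_Archimedean2 by blast
      have "\<forall>\<^sub>F n in sequentially. indicator (?B n) x * w x = w x"
        using eventually_ge_at_top[of N]
      proof eventually_elim
        fix n assume "N \<le> n"
        have "\<bar>x \<bullet> i\<bar> < n" if "i \<in> Basis" for i
          using Basis_le_norm[OF that, of x] N \<open>N \<le> n\<close> by linarith
        then have "x \<in> ?B n" by (force simp: mem_box abs_less_iff)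
        then show "indicator (?B n) x * w x = w x" by simp
      qed
      then show "(\<lambda>n. indicator (?B n) x * w x) \<longlonglongrightarrow> w x" by (rule tendsto_eventually)
    qed
  qed (use w in \<open>auto simp: indicator_def\<close>)
  then have w0: "(\<integral>x. w x \<partial>lborel) = 0"
    by (simp add: z LIMSEQ_const_iff)
  let ?G = "range (\<lambda>(a, b). box a b :: 'a set)"
  fix S :: "'a set" assume "S \<in> sets lborel"
  then have "S \<in> sigma_sets UNIV ?G"
    by (simp add: borel_eq_box)
  have "Int_stable ?G" by (auto simp: Int_stable_def box_Int_box)
  moreover have "?G \<subseteq> Pow UNIV" by simp
  ultimately have "set_lebesgue_integral lborel S w = 0"
    using \<open>S \<in> sigma_sets UNIV ?G\<close>
  proof (induction rule: sigma_sets_induct_disjoint)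
    fix S :: "'a set" assume "S \<in> ?G"
    then show "set_lebesgue_integral lborel S w = 0"
      using z by (auto simp: set_lebesgue_integral_def)
  next
    show "set_lebesgue_integral lborel {} w = 0" by (simp add: set_lebesgue_integral_def)
  next
    fix S assume S: "S \<in> sigma_sets UNIV ?G" "set_lebesgue_integral lborel S w = 0"
    then have [measurable]: "S \<in> sets borel" by (simp add: borel_eq_box)
    have "set_lebesgue_integral lborel (S \<union> (UNIV - S)) w =
      set_lebesgue_integral lborel S w + set_lebesgue_integral lborel (UNIV - S) w"
      by (rule set_integral_Un) (auto intro: si)
    then show "set_lebesgue_integral lborel (UNIV - S) w = 0"
      using S(2) w0 by (simp add: set_lebesgue_integral_def)
  next
    fix F :: "nat \<Rightarrow> 'a set"
    assume F: "disjoint_family F" "range F \<subseteq> sigma_sets UNIV ?G"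
      "\<And>i. set_lebesgue_integral lborel (F i) w = 0"
    then have [measurable]: "\<And>i. F i \<in> sets borel" by (auto simp: borel_eq_box)
    have "set_lebesgue_integral lborel (\<Union>i. F i) w = (\<Sum>i. set_lebesgue_integral lborel (F i) w)"
      using F(1) by (intro lebesgue_integral_countable_add si) (auto simp: disjoint_family_on_def)
    then show "set_lebesgue_integral lborel (\<Union>i. F i) w = 0" by (simp add: F(3))
  qed
  then show "set_lebesgue_integral lborel S w = set_lebesgue_integral lborel S (\<lambda>x. 0)"
    by (simp add: set_lebesgue_integral_def)
qed

text \<open>Integrating over \<open>x\<close> first, translation invariance gives every slice with
  \<open>s\<close> in \<open>{0..h}\<close> the norm of \<open>G\<close>, so only the length of the
  interval enters. The choice \<open>e = 0\<close> covers functions of \<open>x\<close>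
  alone.\<close>

lemma integrable_pair_translate:
  fixes G :: "'a::euclidean_space \<Rightarrow> real" and e :: 'a
  assumes G: "integrable lborel G"
  shows "integrable (lborel \<Otimes>\<^sub>M lborel) (\<lambda>(x, s::real). indicator {0..h} s * G (x + s *\<^sub>R e))"
proof -
  have [measurable]: "G \<in> borel_measurable borel"
    using borel_measurable_integrable[OF G] by simp
  have "integrable (lborel \<Otimes>\<^sub>M lborel) (\<lambda>(s::real, x). indicator {0..h} s * G (x + s *\<^sub>R e))"
  proof (rule lborel_pair.Fubini_integrable)
    have "(\<integral>y. norm (case (s, y) of (s, x) \<Rightarrow> indicator {0..h} s * G (x + s *\<^sub>R e)) \<partial>lborel)
        = indicator {0..h} s * (\<integral>y. \<bar>G y\<bar> \<partial>lborel)" for s :: real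
      using integral_lborel_translate[of "\<lambda>y. \<bar>G y\<bar>" "s *\<^sub>R e"] by (simp add: abs_mult)
    then show "integrable lborel (\<lambda>s. \<integral>y. norm (case (s, y) of (s, x) \<Rightarrow> indicator {0..h} s * G (x + s *\<^sub>R e)) \<partial>lborel)"
      by (simp add: integrable_indicator_iff emeasure_lborel_Icc_eq)
    show "AE s in lborel. integrable lborel (\<lambda>y. case (s, y) of (s, x) \<Rightarrow> indicator {0..h} s * G (x + s *\<^sub>R e))"
      using integrable_lborel_translate[OF G] by simp
  qed measurable
  then show ?thesis
    using lborel_pair.integrable_product_swap_iff[of "\<lambda>(s::real, x). indicator {0..h} s * G (x + s *\<^sub>R e)"]
    by (simp add: case_prod_unfold)
qed

text \<open>Links the gauge integral over \<open>S\<close>, in which weak derivatives are defined,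
  with the Bochner integral of an integrable Borel representative, to which Fubini and translation
  invariance apply.\<close>

lemma integral_eq_lborel_integral:
  fixes f F :: "'a::euclidean_space \<Rightarrow> real"
  assumes F: "integrable lborel F" and ae: "AE x in lborel. F x = (if x \<in> S then f x else 0)"
  shows "integral S f = (\<integral>x. F x \<partial>lborel)"
proof -
  have "AE x in lebesgue. F x = (if x \<in> S then f x else 0)"
    using ae by (rule AE_completion)
  then obtain N where "N \<in> null_sets lebesgue" and N: "{x. F x \<noteq> (if x \<in> S then f x else 0)} \<subseteq> N"
    by (auto simp: eventually_ae_filter)
  then have "((\<lambda>x. if x \<in> S then f x else 0) has_integral (\<integral>x. F x \<partial>lborel)) UNIV"
    using has_integral_integral_lborel[OF F] N
    by (intro has_integral_spike[of N UNIV "\<lambda>x. if x \<in> S then f x else 0" F])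
      (simp_all add: negligible_iff_null_sets subset_iff, metis)
  then show ?thesis
    unfolding has_integral_restrict_UNIV by (rule integral_unique)
qed

text \<open>The difference \<open>w\<close> of the two sides is tested against bumps: the shift is
  moved to the bump, its backward increment is an integral of \<open>pd k \<phi>\<close> over shifts
  \<open>s\<close>, the weak derivative is applied to each shifted bump, and Fubini reassembles the
  integral of \<open>G\<close> along the segment. Bumps converge to indicators of boxes, and these
  detect \<open>w\<close>.\<close>

lemma weak_partial_increment:
  fixes \<Omega> :: "(real^'m::finite) set"
  assumes weak: "weak_partial \<Omega> u k g"
    and U: "integrable lborel U" and G: "integrable lborel G"
    and Uu: "AE x in lborel. x \<in> K \<longrightarrow> U x = u x" and Gg: "AE x in lborel. x \<in> K \<longrightarrow> G x = g x"
    and h: "h \<ge> 0" and K: "cbox p (q + h *\<^sub>R axis k 1) \<subseteq> K" "K \<subseteq> \<Omega>"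
  shows "AE x in lborel. x \<in> box p q \<longrightarrow>
    U (x + h *\<^sub>R axis k 1) - U x = (\<integral>s. indicator {0..h} s * G (x + s *\<^sub>R axis k 1) \<partial>lborel)"
proof -
  let ?e = "axis k 1 :: real^'m"
  have [measurable]: "U \<in> borel_measurable borel" "G \<in> borel_measurable borel"
    using borel_measurable_integrable[OF U] borel_measurable_integrable[OF G] by simp_all
  define J where "J = (\<lambda>x. \<integral>s. indicator {0..h} s * G (x + s *\<^sub>R ?e) \<partial>lborel)"
  define w where "w = (\<lambda>x. U (x + h *\<^sub>R ?e) - U x - J x)"
  have GI: "integrable (lborel \<Otimes>\<^sub>M lborel) (\<lambda>(x, s::real). indicator {0..h} s * G (x + s *\<^sub>R ?e))"
    by (rule integrable_pair_translate[OF G])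
  have J: "integrable lborel J"
    using lborel_pair.integrable_fst'[OF GI] by (simp add: J_def)
  have w: "integrable lborel w"
    unfolding w_def using U J integrable_lborel_translate[OF U] by auto
  have [measurable]: "J \<in> borel_measurable borel" "w \<in> borel_measurable borel"
    using borel_measurable_integrable[OF w] borel_measurable_integrable[OF J] by simp_all
  have bump0: "(\<integral>x. w x * box_bump c a b x \<partial>lborel) = 0"
    if c: "c > 0" and ab: "cbox a b \<subseteq> cbox p q" for c a b
  proof -
    define \<phi> where "\<phi> = box_bump c a b"
    have sub: "cbox (a + s *\<^sub>R ?e) (b + s *\<^sub>R ?e) \<subseteq> K" if "s \<in> {0..h}" for s
    proof
      fix x assume "x \<in> cbox (a + s *\<^sub>R ?e) (b + s *\<^sub>R ?e)"
      then have "x - s *\<^sub>R ?e \<in> cbox a b"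
        by (auto simp: mem_box_cart algebra_simps)
      with ab have "x - s *\<^sub>R ?e \<in> cbox p q" by blast
      then have pq: "p $ i \<le> x $ i - s * ?e $ i" "x $ i - s * ?e $ i \<le> q $ i" for i
        by (auto simp: mem_box_cart)
      have "p $ i \<le> x $ i \<and> x $ i \<le> (q + h *\<^sub>R ?e) $ i" for i
        using pq[of i] that by (auto simp: axis_def split: if_splits)
      then show "x \<in> K" using K(1) by (auto simp: mem_box_cart)
    qed
    have shift: "(\<lambda>x. \<phi> (x - s *\<^sub>R ?e)) = box_bump c (a + s *\<^sub>R ?e) (b + s *\<^sub>R ?e)" for s
      by (simp add: \<phi>_def box_bump_translate fun_eq_iff)
    have tst: "test_fun UNIV \<phi>"
      unfolding \<phi>_def using c by (rule test_fun_box_bump) simp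
    have ts: "test_fun K (\<lambda>x. \<phi> (x - s *\<^sub>R ?e))" if "s \<in> {0..h}" for s
      unfolding shift using c sub[OF that] by (rule test_fun_box_bump)
    obtain C where C: "C > 0" "\<And>x. \<bar>\<phi> x\<bar> \<le> C" "\<And>x. \<bar>pd k \<phi> x\<bar> \<le> C"
      using test_fun_bounded[OF tst] by blast
    have [measurable]: "\<phi> \<in> borel_measurable borel" "pd k \<phi> \<in> borel_measurable borel"
      using test_fun_continuous[OF tst] by (auto intro: borel_measurable_continuous_onI)
    \<comment> \<open>All shifted bumps are supported in \<open>K\<close>, where \<open>U\<close>
      and \<open>G\<close> agree with \<open>u\<close> and \<open>g\<close>. Outside
      \<open>K\<close> the bump and its derivative vanish, so the values of \<open>U\<close> and
      \<open>G\<close> there have no effect.\<close>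
    have weak_s: "(\<integral>x. U x * pd k \<phi> (x - s *\<^sub>R ?e) \<partial>lborel) = - (\<integral>x. G x * \<phi> (x - s *\<^sub>R ?e) \<partial>lborel)"
      if s: "s \<in> {0..h}" for s
    proof -
      let ?\<psi> = "\<lambda>x. \<phi> (x - s *\<^sub>R ?e)"
      have t\<Omega>: "test_fun \<Omega> ?\<psi>" using ts[OF s] K(2) by (auto simp: test_fun_def)
      have out: "?\<psi> x = 0" "pd k ?\<psi> x = 0" if "x \<notin> K" for x
        using test_fun_outside[OF ts[OF s], of x] ts[OF s] that by (auto simp: test_fun_def)
      have pe: "pd k ?\<psi> x = pd k \<phi> (x - s *\<^sub>R ?e)" for x
        by (rule pd_translate[OF tst])
      have "integral \<Omega> (\<lambda>x. u x * pd k ?\<psi> x) = (\<integral>x. U x * pd k \<phi> (x - s *\<^sub>R ?e) \<partial>lborel)"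
      proof (rule integral_eq_lborel_integral)
        show "integrable lborel (\<lambda>x. U x * pd k \<phi> (x - s *\<^sub>R ?e))"
          using C(3) by (intro integrable_mult_bounded[OF U]) auto
        show "AE x in lborel. U x * pd k \<phi> (x - s *\<^sub>R ?e) = (if x \<in> \<Omega> then u x * pd k ?\<psi> x else 0)"
          using Uu
        proof eventually_elim
          case (elim x)
          then show ?case
            using K(2) out[of x] by (cases "x \<in> K") (auto simp: pe)
        qed
      qed
      moreover have "integral \<Omega> (\<lambda>x. g x * ?\<psi> x) = (\<integral>x. G x * \<phi> (x - s *\<^sub>R ?e) \<partial>lborel)"
      proof (rule integral_eq_lborel_integral)
        show "integrable lborel (\<lambda>x. G x * \<phi> (x - s *\<^sub>R ?e))"
          using C(2) by (intro integrable_mult_bounded[OF G]) auto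
        show "AE x in lborel. G x * \<phi> (x - s *\<^sub>R ?e) = (if x \<in> \<Omega> then g x * ?\<psi> x else 0)"
          using Gg
        proof eventually_elim
          case (elim x)
          then show ?case
            using K(2) out[of x] by (cases "x \<in> K") auto
        qed
      qed
      moreover have "integral \<Omega> (\<lambda>x. u x * pd k ?\<psi> x) = - integral \<Omega> (\<lambda>x. g x * ?\<psi> x)"
        using weak t\<Omega> unfolding weak_partial_def by blast
      ultimately show ?thesis by linarith
    qed
    have UI: "integrable (lborel \<Otimes>\<^sub>M lborel) (\<lambda>(x, s::real). (indicator {0..h} s * U x) * pd k \<phi> (x - s *\<^sub>R ?e))"
      using integrable_mult_bounded[OF integrable_pair_translate[OF U, of h 0],
          of "\<lambda>(x, s). pd k \<phi> (x - s *\<^sub>R ?e)" C] C(3)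
      by (simp add: case_prod_unfold)
    have GI': "integrable (lborel \<Otimes>\<^sub>M lborel) (\<lambda>(x, s::real). (indicator {0..h} s * G (x + s *\<^sub>R ?e)) * \<phi> x)"
      using integrable_mult_bounded[OF GI, of "\<lambda>(x, s). \<phi> x" C] C(2)
      by (simp add: case_prod_unfold)
    have "(\<integral>x. U (x + h *\<^sub>R ?e) * \<phi> x \<partial>lborel) - (\<integral>x. U x * \<phi> x \<partial>lborel)
      = (\<integral>x. U x * \<phi> (x - h *\<^sub>R ?e) \<partial>lborel) - (\<integral>x. U x * \<phi> x \<partial>lborel)"
      using integral_lborel_translate[of "\<lambda>x. U x * \<phi> (x - h *\<^sub>R ?e)" "h *\<^sub>R ?e"] by simp
    also have "\<dots> = (\<integral>x. U x * \<phi> (x - h *\<^sub>R ?e) - U x * \<phi> x \<partial>lborel)"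
      by (intro Bochner_Integration.integral_diff[symmetric] integrable_mult_bounded[OF U, where C = C])
         (use C in auto)
    also have "\<dots> = - (\<integral>x. (\<integral>s. (indicator {0..h} s * U x) * pd k \<phi> (x - s *\<^sub>R ?e) \<partial>lborel) \<partial>lborel)"
    proof -
      have "U x * \<phi> (x - h *\<^sub>R ?e) - U x * \<phi> x =
         - (\<integral>s. (indicator {0..h} s * U x) * pd k \<phi> (x - s *\<^sub>R ?e) \<partial>lborel)" for x
      proof -
        have "U x * \<phi> (x - h *\<^sub>R ?e) - U x * \<phi> x = U x * (\<phi> (x - h *\<^sub>R ?e) - \<phi> x)"
          by (simp add: algebra_simps)
        also have "\<dots> = - (U x * (\<integral>s. indicator {0..h} s * pd k \<phi> (x - s *\<^sub>R ?e) \<partial>lborel))"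
          unfolding test_fun_FTC[OF tst h] by simp
        also have "\<dots> = - (\<integral>s. U x * (indicator {0..h} s * pd k \<phi> (x - s *\<^sub>R ?e)) \<partial>lborel)"
          by simp
        also have "(\<lambda>s. U x * (indicator {0..h} s * pd k \<phi> (x - s *\<^sub>R ?e))) =
            (\<lambda>s. (indicator {0..h} s * U x) * pd k \<phi> (x - s *\<^sub>R ?e))"
          by (simp add: fun_eq_iff mult_ac)
        finally show ?thesis .
      qed
      then show ?thesis by simp
    qed
    also have "\<dots> = - (\<integral>s. (\<integral>x. (indicator {0..h} s * U x) * pd k \<phi> (x - s *\<^sub>R ?e) \<partial>lborel) \<partial>lborel)"
      using lborel_pair.Fubini_integral[OF UI] by simp
    also have "\<dots> = (\<integral>s. (\<integral>x. (indicator {0..h} s * G (x + s *\<^sub>R ?e)) * \<phi> x \<partial>lborel) \<partial>lborel)"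
    proof -
      have "- (\<integral>x. (indicator {0..h} s * U x) * pd k \<phi> (x - s *\<^sub>R ?e) \<partial>lborel) =
          (\<integral>x. (indicator {0..h} s * G (x + s *\<^sub>R ?e)) * \<phi> x \<partial>lborel)" for s
      proof (cases "s \<in> {0..h}")
        case True
        have "(\<integral>x. G (x + s *\<^sub>R ?e) * \<phi> x \<partial>lborel) = (\<integral>x. G x * \<phi> (x - s *\<^sub>R ?e) \<partial>lborel)"
          using integral_lborel_translate[of "\<lambda>x. G x * \<phi> (x - s *\<^sub>R ?e)" "s *\<^sub>R ?e"] by simp
        with weak_s[OF True] True show ?thesis by simp
      qed simp
      then show ?thesis by (simp flip: integral_minus)
    qed
    also have "\<dots> = (\<integral>x. (\<integral>s. (indicator {0..h} s * G (x + s *\<^sub>R ?e)) * \<phi> x \<partial>lborel) \<partial>lborel)"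
      using lborel_pair.Fubini_integral[OF GI'] by simp
    also have "\<dots> = (\<integral>x. J x * \<phi> x \<partial>lborel)"
      by (simp add: J_def)
    finally have eq: "(\<integral>x. U (x + h *\<^sub>R ?e) * \<phi> x \<partial>lborel) - (\<integral>x. U x * \<phi> x \<partial>lborel) = (\<integral>x. J x * \<phi> x \<partial>lborel)" .
    have i: "integrable lborel (\<lambda>x. U (x + h *\<^sub>R ?e) * \<phi> x)" "integrable lborel (\<lambda>x. U x * \<phi> x)"
      "integrable lborel (\<lambda>x. J x * \<phi> x)"
      using C(2) by (auto intro!: integrable_mult_bounded[where C = C] integrable_lborel_translate U J)
    have "(\<integral>x. w x * \<phi> x \<partial>lborel) = (\<integral>x. U (x + h *\<^sub>R ?e) * \<phi> x - U x * \<phi> x - J x * \<phi> x \<partial>lborel)"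
      by (simp add: w_def left_diff_distrib)
    also have "\<dots> = 0"
      using eq by (simp only: Bochner_Integration.integral_diff Bochner_Integration.integrable_diff i)
    finally show ?thesis by (simp add: \<phi>_def)
  qed
  have box0: "(\<integral>x. indicator (box a b) x * w x \<partial>lborel) = 0" if ab: "cbox a b \<subseteq> cbox p q" for a b
  proof -
    have "(\<lambda>n. \<integral>x. w x * box_bump (1 / Suc n) a b x \<partial>lborel) \<longlonglongrightarrow> (\<integral>x. indicator (box a b) x * w x \<partial>lborel)"
    proof (rule integral_dominated_convergence[where w = "\<lambda>x. \<bar>w x\<bar>"])
      have "box_bump (1 / Suc n) a b \<in> borel_measurable borel" for n
        using test_fun_continuous(1)[OF test_fun_box_bump[of "1 / Suc n" a b UNIV]]
        by (intro borel_measurable_continuous_onI) auto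
      then show "(\<lambda>x. w x * box_bump (1 / Suc n) a b x) \<in> borel_measurable lborel" for n
        by measurable
      show "AE x in lborel. (\<lambda>n. w x * box_bump (1 / Suc n) a b x) \<longlonglongrightarrow> indicator (box a b) x * w x"
        using tendsto_mult[OF tendsto_const box_bump_tendsto_indicator]
        by (intro AE_I2) (simp add: mult.commute)
      show "AE x in lborel. norm (w x * box_bump (1 / Suc n) a b x) \<le> \<bar>w x\<bar>" for n
        using box_bump_bounds[of "1 / Suc n" a b]
        by (intro AE_I2) (simp add: abs_mult mult_left_le)
    qed (use w in auto)
    moreover have "(\<integral>x. w x * box_bump (1 / Suc n) a b x \<partial>lborel) = 0" for n
      by (rule bump0[OF _ ab]) simp
    ultimately show ?thesis by (simp add: LIMSEQ_const_iff)
  qed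
  have "AE x in lborel. indicator (box p q) x * w x = 0"
  proof (rule AE_zero_if_box_integrals_zero)
    show "integrable lborel (\<lambda>x. indicator (box p q) x * w x)"
      using integrable_mult_indicator[of "box p q" lborel w] w by simp
    fix a b :: "real^'m"
    obtain a' b' where ab': "box a b \<inter> box p q = box a' b'"
      using box_Int_box by blast
    have eq: "(\<integral>x. indicator (box a b) x * (indicator (box p q) x * w x) \<partial>lborel) = (\<integral>x. indicator (box a' b') x * w x \<partial>lborel)"
      by (simp add: mult.assoc[symmetric] indicator_inter_arith[symmetric] ab')
    \<comment> \<open>An empty \<open>box a' b'\<close> may come with corners for which
      \<open>cbox a' b'\<close> is nonempty and leaves \<open>cbox p q\<close>. Only for a nonempty
      box is \<open>cbox a' b'\<close> its closure, hence the case distinction.\<close>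
    show "(\<integral>x. indicator (box a b) x * (indicator (box p q) x * w x) \<partial>lborel) = 0"
    proof (cases "box a' b' = {}")
      case False
      have "cbox a' b' = closure (box a' b')" using False by simp
      also have "\<dots> \<subseteq> cbox p q"
        using ab' box_subset_cbox[of p q] by (intro closure_minimal closed_cbox) blast
      finally show ?thesis using eq box0 by simp
    qed (simp add: eq)
  qed
  then show ?thesis
  proof eventually_elim
    case (elim x)
    show ?case
    proof
      assume "x \<in> box p q"
      with elim have "w x = 0" by simp
      then show "U (x + h *\<^sub>R ?e) - U x = (\<integral>s. indicator {0..h} s * G (x + s *\<^sub>R ?e) \<partial>lborel)"
        by (simp add: w_def J_def)
    qed
  qed
qed

section \<open>Iterated integrals of almost constant functions\<close>

definition indef_int :: "(real \<Rightarrow> real) \<Rightarrow> real \<Rightarrow> real" where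
  "indef_int a s = (\<integral>t. indicator {0..s} t * a t \<partial>lborel)"

lemma borel_measurable_indef_int [measurable]:
  assumes [measurable]: "a \<in> borel_measurable borel"
  shows "indef_int a \<in> borel_measurable borel"
proof -
  \<comment> \<open>Writing \<open>t \<le> s\<close> as membership of \<open>s - t\<close> in
    \<open>{0..}\<close> makes the integrand visibly measurable in both variables together. For
    negative \<open>s\<close> both sides are zero.\<close>
  have eq: "indef_int a = (\<lambda>s. \<integral>t. (indicator {0..} t * indicator {0..} (s - t)) * a t \<partial>lborel)"
    unfolding indef_int_def fun_eq_iff
    by (auto intro!: Bochner_Integration.integral_cong simp: indicator_def)
  show ?thesis unfolding eq by measurable
qed

lemma integrable_indicator_Icc_0: "integrable lborel (indicator {0..h::real} :: real \<Rightarrow> real)"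
  by (simp add: integrable_indicator_iff emeasure_lborel_Icc_eq)

lemma integrable_Icc_restrict:
  fixes a :: "real \<Rightarrow> real"
  assumes "integrable lborel (\<lambda>s. indicator {0..h} s * a s)" "s \<le> h"
  shows "integrable lborel (\<lambda>t. indicator {0..s} t * a t)"
proof -
  have "integrable lborel (\<lambda>t. indicator {0..s} t *\<^sub>R (indicator {0..h} t * a t))"
    using assms(1) by (intro integrable_mult_indicator) auto
  also have "(\<lambda>t. indicator {0..s} t *\<^sub>R (indicator {0..h} t * a t)) = (\<lambda>t. indicator {0..s} t * a t)"
    using assms(2) by (auto simp: fun_eq_iff indicator_def)
  finally show ?thesis .
qed

lemma integrable_Icc_diff_const:
  fixes a :: "real \<Rightarrow> real"
  assumes "integrable lborel (\<lambda>s. indicator {0..h} s * a s)"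
  shows "integrable lborel (\<lambda>s. indicator {0..h} s * (a s - A))"
    and "integrable lborel (\<lambda>s. indicator {0..h} s * \<bar>a s - A\<bar>)"
proof -
  have "integrable lborel (\<lambda>s. indicator {0..h} s * a s - indicator {0..h} s * A)"
    using assms integrable_indicator_Icc_0 by (intro Bochner_Integration.integrable_diff) auto
  then show i: "integrable lborel (\<lambda>s. indicator {0..h} s * (a s - A))"
    by (simp add: right_diff_distrib)
  show "integrable lborel (\<lambda>s. indicator {0..h} s * \<bar>a s - A\<bar>)"
    using integrable_abs[OF i] by (simp add: abs_mult)
qed

lemma integral_Icc_const:
  assumes "0 \<le> h"
  shows "(\<integral>s. indicator {0..h::real} s * (A::real) \<partial>lborel) = h * A"
  using assms by simp

lemma integral_Icc_id:
  assumes "0 \<le> h"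
  shows "(\<integral>s. indicator {0..h::real} s * (s * A) \<partial>lborel) = h\<^sup>2 * A / 2"
    and "integrable lborel (\<lambda>s. indicator {0..h::real} s * (s * A))"
proof -
  have d: "((\<lambda>s. s\<^sup>2 * A / 2) has_vector_derivative (s * A)) (at s within {0..h})" for s
    unfolding has_real_derivative_iff_has_vector_derivative[symmetric]
    by (auto intro!: derivative_eq_intros)
  have c: "continuous_on {0..h} (\<lambda>s. s * A)" by (intro continuous_intros)
  show "(\<integral>s. indicator {0..h::real} s * (s * A) \<partial>lborel) = h\<^sup>2 * A / 2"
    using integral_FTC_atLeastAtMost[OF assms d c] by simp
  show "integrable lborel (\<lambda>s. indicator {0..h::real} s * (s * A))"
    using borel_integrable_atLeastAtMost'[OF c] by (simp add: set_integrable_def)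
qed

lemma indef_int_diff_le:
  assumes "integrable lborel (\<lambda>s. indicator {0..h} s * a s)" "0 \<le> s" "s \<le> h"
  shows "\<bar>indef_int a s - s * A\<bar> \<le> (\<integral>t. indicator {0..h} t * \<bar>a t - A\<bar> \<partial>lborel)"
proof -
  note i = integrable_Icc_restrict[OF assms(1,3)]
  have "indef_int a s - s * A = (\<integral>t. indicator {0..s} t * a t \<partial>lborel) - (\<integral>t. indicator {0..s} t * A \<partial>lborel)"
    unfolding indef_int_def integral_Icc_const[OF assms(2)] ..
  also have "\<dots> = (\<integral>t. indicator {0..s} t * a t - indicator {0..s} t * A \<partial>lborel)"
    using i integrable_indicator_Icc_0
    by (intro Bochner_Integration.integral_diff[symmetric]) auto
  also have "\<dots> = (\<integral>t. indicator {0..s} t * (a t - A) \<partial>lborel)"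
    by (simp add: right_diff_distrib)
  also have "\<bar>\<dots>\<bar> \<le> (\<integral>t. \<bar>indicator {0..s} t * (a t - A)\<bar> \<partial>lborel)"
    by (rule integral_abs_bound)
  also have "\<dots> \<le> (\<integral>t. indicator {0..h} t * \<bar>a t - A\<bar> \<partial>lborel)"
    using assms(3) integrable_Icc_diff_const[OF assms(1)] integrable_Icc_diff_const[OF i]
    by (intro integral_mono) (auto simp: abs_mult indicator_def)
  finally show ?thesis .
qed

text \<open>An indefinite integral is bounded on \<open>{0..h}\<close>; the bound is
  \<open>indef_int_diff_le\<close> with the constant 0. This is where working on segments pays:
  boundedness makes the product integrable.\<close>

lemma integrable_indef_int_mult:
  assumes [measurable]: "a \<in> borel_measurable borel"
    and a: "integrable lborel (\<lambda>s. indicator {0..h} s * a s)"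
    and b: "integrable lborel (\<lambda>s. indicator {0..h} s * b s)"
  shows "integrable lborel (\<lambda>s. indicator {0..h} s * (indef_int a s * b s))"
proof -
  define C where "C = (\<integral>t. indicator {0..h} t * \<bar>a t - 0\<bar> \<partial>lborel)"
  have C: "\<bar>indef_int a s\<bar> \<le> C" if "s \<in> {0..h}" for s
    using indef_int_diff_le[OF a, of s 0] that by (simp add: C_def)
  have "integrable lborel (\<lambda>s. indef_int a s * (indicator {0..h} s * b s))"
  proof (rule Bochner_Integration.integrable_bound[of _ "\<lambda>s. C * (indicator {0..h} s * b s)"])
    show "(\<lambda>s. indef_int a s * (indicator {0..h} s * b s)) \<in> borel_measurable lborel"
      using borel_measurable_integrable[OF b] by simp
    have "\<bar>indef_int a s\<bar> * \<bar>b s\<bar> \<le> \<bar>C\<bar> * \<bar>b s\<bar>" if "s \<in> {0..h}" for s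
      using C[OF that] by (intro mult_right_mono) auto
    then show "AE s in lborel. norm (indef_int a s * (indicator {0..h} s * b s)) \<le> norm (C * (indicator {0..h} s * b s))"
      by (intro AE_I2) (auto simp: indicator_def abs_mult)
  qed (use b in simp)
  then show ?thesis by (simp add: mult_ac)
qed

text \<open>For constant functions \<open>A\<close> and \<open>B\<close> the integral is exactly
  \<open>h^2 * (A * B) / 2\<close>. The error is quadratically small: if \<open>\<epsilon>\<close>
  and \<open>\<delta>\<close> are \<open>o(h)\<close>, the bound is \<open>o(h^2)\<close>.\<close>

lemma integral_indef_int_mult_approx:
  fixes A B h :: real
  assumes h: "0 \<le> h" and [measurable]: "a \<in> borel_measurable borel"
    and a: "integrable lborel (\<lambda>s. indicator {0..h} s * a s)"
    and b: "integrable lborel (\<lambda>s. indicator {0..h} s * b s)"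
  defines "\<epsilon> \<equiv> (\<integral>t. indicator {0..h} t * \<bar>a t - A\<bar> \<partial>lborel)"
    and "\<delta> \<equiv> (\<integral>t. indicator {0..h} t * \<bar>b t - B\<bar> \<partial>lborel)"
  shows "\<bar>(\<integral>s. indicator {0..h} s * (indef_int a s * b s) \<partial>lborel) - h\<^sup>2 * (A * B) / 2\<bar>
    \<le> \<epsilon> * (h * \<bar>B\<bar> + \<delta>) + h * \<bar>A\<bar> * \<delta>"
proof -
  note iab = integrable_indef_int_mult[OF assms(2) a b] and iid = integral_Icc_id[OF h, of "A * B"]
    and ib = integrable_Icc_diff_const[OF b, of B]
  have \<epsilon>: "\<epsilon> \<ge> 0" unfolding \<epsilon>_def by (intro integral_nonneg_AE AE_I2) simp
  have iB: "integrable lborel (\<lambda>s. indicator {0..h} s * \<bar>B\<bar>)"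
    using integrable_indicator_Icc_0 by auto
  have eq: "(\<integral>s. indicator {0..h} s * (indef_int a s * b s) \<partial>lborel) - h\<^sup>2 * (A * B) / 2
    = (\<integral>s. indicator {0..h} s * (indef_int a s * b s) - indicator {0..h} s * (s * (A * B)) \<partial>lborel)"
    using iid iab by simp
  have "\<bar>(\<integral>s. indicator {0..h} s * (indef_int a s * b s) \<partial>lborel) - h\<^sup>2 * (A * B) / 2\<bar>
    \<le> (\<integral>s. \<bar>indicator {0..h} s * (indef_int a s * b s) - indicator {0..h} s * (s * (A * B))\<bar> \<partial>lborel)"
    unfolding eq by (rule integral_abs_bound)
  also have "\<dots> \<le> (\<integral>s. \<epsilon> * (indicator {0..h} s * \<bar>B\<bar>) + (\<epsilon> + h * \<bar>A\<bar>) * (indicator {0..h} s * \<bar>b s - B\<bar>) \<partial>lborel)"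
  proof (rule integral_mono)
    show "integrable lborel (\<lambda>s. \<bar>indicator {0..h} s * (indef_int a s * b s) - indicator {0..h} s * (s * (A * B))\<bar>)"
      by (rule integrable_abs, rule Bochner_Integration.integrable_diff[OF iab iid(2)])
    show "integrable lborel (\<lambda>s. \<epsilon> * (indicator {0..h} s * \<bar>B\<bar>) + (\<epsilon> + h * \<bar>A\<bar>) * (indicator {0..h} s * \<bar>b s - B\<bar>))"
      by (rule Bochner_Integration.integrable_add; rule integrable_mult_right) (rule iB ib)+
    fix s :: real
    show "\<bar>indicator {0..h} s * (indef_int a s * b s) - indicator {0..h} s * (s * (A * B))\<bar>
      \<le> \<epsilon> * (indicator {0..h} s * \<bar>B\<bar>) + (\<epsilon> + h * \<bar>A\<bar>) * (indicator {0..h} s * \<bar>b s - B\<bar>)"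
    proof (cases "s \<in> {0..h}")
      case True
      have e: "\<bar>indef_int a s - s * A\<bar> \<le> \<epsilon>"
        unfolding \<epsilon>_def by (rule indef_int_diff_le[OF a]) (use True in auto)
      \<comment> \<open>The error of the first factor multiplies \<open>b s\<close>, which is not
        bounded; therefore \<open>\<bar>b s\<bar>\<close> is split into \<open>\<bar>B\<bar>\<close>
        and \<open>\<bar>b s - B\<bar>\<close>, whose integral is \<open>\<delta>\<close>.\<close>
      have "\<bar>indef_int a s * b s - s * (A * B)\<bar> = \<bar>(indef_int a s - s * A) * b s + s * A * (b s - B)\<bar>"
        by (simp add: algebra_simps)
      also have "\<dots> \<le> \<bar>indef_int a s - s * A\<bar> * \<bar>b s\<bar> + s * \<bar>A\<bar> * \<bar>b s - B\<bar>"
        using abs_triangle_ineq[of "(indef_int a s - s * A) * b s" "s * A * (b s - B)"] True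
        by (simp add: abs_mult)
      also have "\<dots> \<le> \<epsilon> * (\<bar>B\<bar> + \<bar>b s - B\<bar>) + h * \<bar>A\<bar> * \<bar>b s - B\<bar>"
        using True e \<epsilon> by (intro add_mono mult_mono) auto
      finally show ?thesis using True by (simp add: algebra_simps)
    qed simp
  qed
  also have "\<dots> = \<epsilon> * (\<integral>s. indicator {0..h} s * \<bar>B\<bar> \<partial>lborel) + (\<epsilon> + h * \<bar>A\<bar>) * \<delta>"
    unfolding \<delta>_def integral_mult_right_zero[symmetric]
    by (rule Bochner_Integration.integral_add; rule integrable_mult_right) (rule iB ib)+
  also have "\<dots> = \<epsilon> * (h * \<bar>B\<bar> + \<delta>) + h * \<bar>A\<bar> * \<delta>"
    unfolding integral_Icc_const[OF h] by (simp add: algebra_simps)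
  finally show ?thesis .
qed

lemma indef_int_mean_tendsto:
  assumes h: "\<And>n::nat. h n > 0"
    and a: "\<And>n. integrable lborel (\<lambda>s. indicator {0..h n} s * a n s)"
    and lim: "(\<lambda>n. (\<integral>t. indicator {0..h n} t * \<bar>a n t - A\<bar> \<partial>lborel) / h n) \<longlonglongrightarrow> 0"
  shows "(\<lambda>n. indef_int (a n) (h n) / h n) \<longlonglongrightarrow> A"
proof -
  have "(\<lambda>n. indef_int (a n) (h n) / h n - A) \<longlonglongrightarrow> 0"
  proof (rule Lim_null_comparison[OF always_eventually lim], rule allI)
    fix n
    have "\<bar>indef_int (a n) (h n) - h n * A\<bar> \<le> (\<integral>t. indicator {0..h n} t * \<bar>a n t - A\<bar> \<partial>lborel)"
      using indef_int_diff_le[OF a, of "h n"] h[of n] by simp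
    moreover have "indef_int (a n) (h n) / h n - A = (indef_int (a n) (h n) - h n * A) / h n"
      using h[of n] by (simp add: field_simps)
    ultimately show "norm (indef_int (a n) (h n) / h n - A) \<le> (\<integral>t. indicator {0..h n} t * \<bar>a n t - A\<bar> \<partial>lborel) / h n"
      using h[of n] by (simp add: divide_right_mono)
  qed
  then show ?thesis by (simp add: LIM_zero_iff)
qed

text \<open>The limit is symmetric in \<open>A\<close> and \<open>B\<close>, so the antisymmetric
  combinations that occur along a single side disappear after division by
  \<open>h^2\<close>.\<close>

lemma indef_int_mult_mean_tendsto:
  assumes h: "\<And>n::nat. h n > 0" and [measurable]: "\<And>n. a n \<in> borel_measurable borel"
    and a: "\<And>n. integrable lborel (\<lambda>s. indicator {0..h n} s * a n s)"
    and b: "\<And>n. integrable lborel (\<lambda>s. indicator {0..h n} s * b n s)"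
    and lima: "(\<lambda>n. (\<integral>t. indicator {0..h n} t * \<bar>a n t - A\<bar> \<partial>lborel) / h n) \<longlonglongrightarrow> 0"
    and limb: "(\<lambda>n. (\<integral>t. indicator {0..h n} t * \<bar>b n t - B\<bar> \<partial>lborel) / h n) \<longlonglongrightarrow> 0"
  shows "(\<lambda>n. (\<integral>s. indicator {0..h n} s * (indef_int (a n) s * b n s) \<partial>lborel) / (h n)\<^sup>2) \<longlonglongrightarrow> A * B / 2"
proof -
  define \<epsilon> where "\<epsilon> n = (\<integral>t. indicator {0..h n} t * \<bar>a n t - A\<bar> \<partial>lborel)" for n
  define \<delta> where "\<delta> n = (\<integral>t. indicator {0..h n} t * \<bar>b n t - B\<bar> \<partial>lborel)" for n
  define X where "X n = (\<integral>s. indicator {0..h n} s * (indef_int (a n) s * b n s) \<partial>lborel)" for n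
  have "(\<lambda>n. \<epsilon> n / h n * (\<bar>B\<bar> + \<delta> n / h n) + \<bar>A\<bar> * (\<delta> n / h n)) \<longlonglongrightarrow> 0 * (\<bar>B\<bar> + 0) + \<bar>A\<bar> * 0"
    using lima limb unfolding \<epsilon>_def[symmetric] \<delta>_def[symmetric] by (intro tendsto_intros)
  then have lim: "(\<lambda>n. \<epsilon> n / h n * (\<bar>B\<bar> + \<delta> n / h n) + \<bar>A\<bar> * (\<delta> n / h n)) \<longlonglongrightarrow> 0"
    by simp
  have "(\<lambda>n. X n / (h n)\<^sup>2 - A * B / 2) \<longlonglongrightarrow> 0"
  proof (rule Lim_null_comparison[OF always_eventually lim], rule allI)
    fix n
    have hn: "h n > 0" by (rule h)
    have "\<bar>X n - (h n)\<^sup>2 * (A * B) / 2\<bar> \<le> \<epsilon> n * (h n * \<bar>B\<bar> + \<delta> n) + h n * \<bar>A\<bar> * \<delta> n"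
      unfolding X_def \<epsilon>_def \<delta>_def
      using h[of n] by (intro integral_indef_int_mult_approx a b) auto
    then have "\<bar>X n - (h n)\<^sup>2 * (A * B) / 2\<bar> / (h n)\<^sup>2 \<le> (\<epsilon> n * (h n * \<bar>B\<bar> + \<delta> n) + h n * \<bar>A\<bar> * \<delta> n) / (h n)\<^sup>2"
      by (rule divide_right_mono) simp
    moreover have "X n / (h n)\<^sup>2 - A * B / 2 = (X n - (h n)\<^sup>2 * (A * B) / 2) / (h n)\<^sup>2"
      using hn by (simp add: field_simps)
    moreover have "(\<epsilon> n * (h n * \<bar>B\<bar> + \<delta> n) + h n * \<bar>A\<bar> * \<delta> n) / (h n)\<^sup>2
      = \<epsilon> n / h n * (\<bar>B\<bar> + \<delta> n / h n) + \<bar>A\<bar> * (\<delta> n / h n)"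
      using hn by (simp add: field_simps power2_eq_square)
    ultimately show "norm (X n / (h n)\<^sup>2 - A * B / 2) \<le> \<epsilon> n / h n * (\<bar>B\<bar> + \<delta> n / h n) + \<bar>A\<bar> * (\<delta> n / h n)"
      by simp
  qed
  then show ?thesis by (simp add: LIM_zero_iff X_def)
qed

section \<open>Segment averages converge in \<open>L\<^sup>1\<close>\<close>

lemma integrable_pair_segment_diff:
  fixes G :: "'a::euclidean_space \<Rightarrow> real" and c e :: 'a
  assumes G: "integrable lborel G"
  shows "integrable (lborel \<Otimes>\<^sub>M lborel) (\<lambda>(x, s::real). indicator {0..h} s * \<bar>G (x + c + s *\<^sub>R e) - G x\<bar>)"
proof -
  have 1: "integrable (lborel \<Otimes>\<^sub>M lborel) (\<lambda>(x, s::real). indicator {0..h} s * G (x + s *\<^sub>R e + c))"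
    using integrable_pair_translate[OF integrable_lborel_translate[OF G, of c], of h e] .
  have 2: "integrable (lborel \<Otimes>\<^sub>M lborel) (\<lambda>(x, s::real). indicator {0..h} s * G x)"
    using integrable_pair_translate[OF G, of h 0] by simp
  have "(\<lambda>(x, s). indicator {0..h} s * \<bar>G (x + c + s *\<^sub>R e) - G x\<bar>) =
    (\<lambda>z. \<bar>(case z of (x, s) \<Rightarrow> indicator {0..h} s * G (x + s *\<^sub>R e + c)) - (case z of (x, s) \<Rightarrow> indicator {0..h} s * G x)\<bar>)"
    by (auto simp: fun_eq_iff indicator_def add_ac)
  then show ?thesis
    using integrable_abs[OF Bochner_Integration.integrable_diff[OF 1 2]] by simp
qed

text \<open>By Fubini the integral is the mean over \<open>s\<close> of the \<open>L^1\<close>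
  distance \<open>\<tau>\<close> between \<open>G\<close> and its translate by
  \<open>c n + s *\<^sub>R e\<close>. These translations are small uniformly in \<open>s\<close>, so
  continuity of \<open>\<tau>\<close> at 0 suffices.\<close>

lemma segment_average_tendsto_L1:
  fixes G :: "'a::euclidean_space \<Rightarrow> real" and c :: "nat \<Rightarrow> 'a" and e :: 'a
  assumes G: "integrable lborel G" and h: "\<And>n. h n > 0" "h \<longlonglongrightarrow> 0" and c: "c \<longlonglongrightarrow> 0"
  shows "(\<lambda>n. \<integral>x. (\<integral>s. indicator {0..h n} s * \<bar>G (x + c n + s *\<^sub>R e) - G x\<bar> \<partial>lborel) / h n \<partial>lborel) \<longlonglongrightarrow> 0"
    (is "?I \<longlonglongrightarrow> 0")
proof -
  define \<tau> where "\<tau> v = (\<integral>x. \<bar>G (x + v) - G x\<bar> \<partial>lborel)" for v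
  have \<tau>0: "\<tau> v \<ge> 0" for v unfolding \<tau>_def by (intro integral_nonneg_AE AE_I2) simp
  have "isCont \<tau> 0"
    unfolding continuous_at_sequentially
    using translation_continuous_L1[OF G] by (auto simp: \<tau>_def o_def)
  have I: "?I n = (\<integral>s. indicator {0..h n} s * \<tau> (c n + s *\<^sub>R e) \<partial>lborel) / h n" for n
  proof -
    have "?I n = (\<integral>x. (\<integral>s. indicator {0..h n} s * \<bar>G (x + c n + s *\<^sub>R e) - G x\<bar> \<partial>lborel) \<partial>lborel) / h n"
      by simp
    also have "(\<integral>x. (\<integral>s. indicator {0..h n} s * \<bar>G (x + c n + s *\<^sub>R e) - G x\<bar> \<partial>lborel) \<partial>lborel)
      = (\<integral>s. (\<integral>x. indicator {0..h n} s * \<bar>G (x + c n + s *\<^sub>R e) - G x\<bar> \<partial>lborel) \<partial>lborel)"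
      using lborel_pair.Fubini_integral[OF integrable_pair_segment_diff[OF G]] by simp
    also have "\<dots> = (\<integral>s. indicator {0..h n} s * \<tau> (c n + s *\<^sub>R e) \<partial>lborel)"
      by (simp add: \<tau>_def add.assoc)
    finally show ?thesis .
  qed
  have iI: "integrable lborel (\<lambda>s. indicator {0..h n} s * \<tau> (c n + s *\<^sub>R e))" for n
    using lborel_pair.integrable_snd[OF integrable_pair_segment_diff[OF G, of "h n" "c n" e]]
    by (simp add: \<tau>_def add.assoc)
  show ?thesis
  proof (rule LIMSEQ_I)
    fix r :: real assume r: "r > 0"
    have "(\<tau> \<longlongrightarrow> 0) (at 0)"
      using \<open>isCont \<tau> 0\<close> by (simp add: isCont_def \<tau>_def)
    then obtain d where d: "d > 0" "\<And>v. v \<noteq> 0 \<Longrightarrow> norm v < d \<Longrightarrow> \<tau> v < r / 2"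
      using r \<tau>0 unfolding LIM_eq by (auto dest!: spec[of _ "r/2"])
    \<comment> \<open>The punctured limit says nothing about \<open>v = 0\<close>, where
      \<open>\<tau>\<close> is zero by definition.\<close>
    have d': "\<tau> v \<le> r / 2" if "norm v < d" for v
      using d(2)[of v] that r by (cases "v = 0") (auto simp: \<tau>_def)
    have "(\<lambda>n. norm (c n) + h n * norm e) \<longlonglongrightarrow> 0 + 0 * norm e"
      using c h(2) by (intro tendsto_intros tendsto_norm_zero)
    then have "\<forall>\<^sub>F n in sequentially. norm (c n) + h n * norm e < d"
      using d(1) by (intro order_tendstoD(2)) auto
    then obtain N where N: "\<And>n. n \<ge> N \<Longrightarrow> norm (c n) + h n * norm e < d"
      by (auto simp: eventually_sequentially)
    have "norm (?I n - 0) < r" if "n \<ge> N" for n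
    proof -
      have le: "indicator {0..h n} s * \<tau> (c n + s *\<^sub>R e) \<le> indicator {0..h n} s * (r / 2)" for s
      proof (cases "s \<in> {0..h n}")
        case True
        have "norm (c n + s *\<^sub>R e) \<le> norm (c n) + s * norm e"
          using norm_triangle_ineq[of "c n" "s *\<^sub>R e"] True by simp
        also have "\<dots> \<le> norm (c n) + h n * norm e"
          using True by (intro add_left_mono mult_right_mono) auto
        also have "\<dots> < d" using N that by blast
        finally show ?thesis using d' True by simp
      qed simp
      have "(\<integral>s. indicator {0..h n} s * \<tau> (c n + s *\<^sub>R e) \<partial>lborel) \<le> (\<integral>s. indicator {0..h n} s * (r / 2) \<partial>lborel)"
        using le integrable_indicator_Icc_0 by (intro integral_mono iI) auto
      also have "\<dots> = h n * (r / 2)" using h(1)[of n] by (intro integral_Icc_const) simp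
      finally have "?I n \<le> r / 2"
        unfolding I using h(1)[of n] by (simp add: divide_le_eq mult.commute)
      moreover have "?I n \<ge> 0"
        using h(1)[of n] by (intro integral_nonneg_AE AE_I2 divide_nonneg_nonneg) auto
      ultimately have "\<bar>?I n\<bar> < r" using r by linarith
      then show ?thesis by (simp only: diff_0_right real_norm_def)
    qed
    then show "\<exists>no. \<forall>n\<ge>no. norm (?I n - 0) < r" by (intro exI[of _ N] allI impI)
  qed
qed

text \<open>Convergence in \<open>L^1\<close> gives convergence almost everywhere only along a
  subsequence. Applying this to the sum of the finitely many nonnegative families yields one
  subsequence for all of them, since each family is bounded by the sum.\<close>

lemma segment_averages_subseq:
  fixes G :: "'i \<Rightarrow> 'a::euclidean_space \<Rightarrow> real" and c :: "'i \<Rightarrow> nat \<Rightarrow> 'a" and e :: "'i \<Rightarrow> 'a"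
  assumes S: "finite S" and G: "\<And>i. i \<in> S \<Longrightarrow> integrable lborel (G i)"
    and h: "\<And>n. h n > 0" "h \<longlonglongrightarrow> 0" and c: "\<And>i. i \<in> S \<Longrightarrow> c i \<longlonglongrightarrow> 0"
  obtains r where "strict_mono r"
    "AE x in lborel. \<forall>i\<in>S. (\<lambda>n. (\<integral>s. indicator {0..h (r n)} s * \<bar>G i (x + c i (r n) + s *\<^sub>R e i) - G i x\<bar> \<partial>lborel) / h (r n)) \<longlonglongrightarrow> 0"
proof -
  define u where "u i n x = (\<integral>s. indicator {0..h n} s * \<bar>G i (x + c i n + s *\<^sub>R e i) - G i x\<bar> \<partial>lborel) / h n" for i n x
  have u0: "u i n x \<ge> 0" for i n x
    unfolding u_def using h(1)[of n] by (intro divide_nonneg_nonneg integral_nonneg_AE AE_I2) auto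
  have iu: "integrable lborel (u i n)" if "i \<in> S" for i n
    using lborel_pair.integrable_fst'[OF integrable_pair_segment_diff[OF G[OF that], of "h n" "c i n" "e i"]]
    by (simp add: u_def[abs_def])
  have "(\<lambda>n. \<Sum>i\<in>S. \<integral>x. u i n x \<partial>lborel) \<longlonglongrightarrow> (\<Sum>i\<in>S. 0)"
    unfolding u_def by (intro tendsto_sum segment_average_tendsto_L1 G h c)
  moreover have "(\<integral>x. norm (\<Sum>i\<in>S. u i n x) \<partial>lborel) = (\<Sum>i\<in>S. \<integral>x. u i n x \<partial>lborel)" for n
    using u0 iu by (simp add: sum_nonneg)
  ultimately have "(\<lambda>n. \<integral>x. norm (\<Sum>i\<in>S. u i n x) \<partial>lborel) \<longlonglongrightarrow> 0" by simp
  then obtain r where r: "strict_mono r" "AE x in lborel. (\<lambda>n. \<Sum>i\<in>S. u i (r n) x) \<longlonglongrightarrow> 0"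
    using tendsto_L1_AE_subseq[of lborel "\<lambda>n x. \<Sum>i\<in>S. u i n x"] iu by auto
  have "AE x in lborel. \<forall>i\<in>S. (\<lambda>n. u i (r n) x) \<longlonglongrightarrow> 0"
    using r(2)
  proof eventually_elim
    case (elim x)
    show ?case
    proof
      fix i assume i: "i \<in> S"
      show "(\<lambda>n. u i (r n) x) \<longlonglongrightarrow> 0"
        by (rule tendsto_sandwich[OF _ _ tendsto_const elim])
          (use u0 i S in \<open>auto intro!: always_eventually member_le_sum\<close>)
    qed
  qed
  then show ?thesis using r(1) that unfolding u_def by blast
qed

section \<open>Horizontal segments and squares\<close>

text \<open>For integrable \<open>a\<close> and \<open>b\<close>, the double integral of
  \<open>a t * b s\<close> over the triangle \<open>0 \<le> t \<le> s \<le> h\<close>. The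
  difference \<open>iter_int h a b - iter_int h b a\<close> is twice the Levy area of the plane path
  with velocity \<open>(a, b)\<close>.\<close>

definition iter_int :: "real \<Rightarrow> (real \<Rightarrow> real) \<Rightarrow> (real \<Rightarrow> real) \<Rightarrow> real" where
  "iter_int h a b = (\<integral>s. indicator {0..h} s * (indef_int a s * b s) \<partial>lborel)"

text \<open>The last clause is the contact equation integrated along the segment, with the
  components expanded around their values at \<open>y\<close>: a part linear in these values plus
  twice the Levy areas of the conjugate pairs. Being a condition on one \<open>y\<close> and one
  \<open>h\<close>, it can hold for almost every \<open>y\<close> without a choice of precise
  representatives.\<close>

definition horizontal_segment ::
  "nat \<Rightarrow> (nat \<Rightarrow> 'a::euclidean_space \<Rightarrow> real) \<Rightarrow> (nat \<Rightarrow> 'a \<Rightarrow> real) \<Rightarrow> 'a \<Rightarrow> real \<Rightarrow> 'a \<Rightarrow> bool" where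
  "horizontal_segment n F D e h y \<longleftrightarrow> (let a = (\<lambda>j s. D j (y + s *\<^sub>R e)) in
     (\<forall>j. integrable lborel (\<lambda>s. indicator {0..h} s * a j s)) \<and>
     (\<forall>j\<in>{1..2*n+1}. F j (y + h *\<^sub>R e) = F j y + indef_int (a j) h) \<and>
     F (2*n+1) (y + h *\<^sub>R e) - F (2*n+1) y =
       (\<Sum>j=1..n. F j y * indef_int (a (j+n)) h - F (j+n) y * indef_int (a j) h
          + (iter_int h (a j) (a (j+n)) - iter_int h (a (j+n)) (a j))))"

text \<open>Joint measurability in base point and length is what allows the quantifiers "almost
  every \<open>y\<close>" and "almost every \<open>s\<close>" to be exchanged.\<close>

lemma borel_measurable_indef_int_pair:
  fixes G :: "'a::euclidean_space \<Rightarrow> real" and e :: 'a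
  assumes [measurable]: "G \<in> borel_measurable borel"
  shows "(\<lambda>z. indef_int (\<lambda>s. G (fst z + s *\<^sub>R e)) (snd z)) \<in> borel_measurable (lborel \<Otimes>\<^sub>M lborel)"
proof -
  have "(\<lambda>z. indef_int (\<lambda>s. G (fst z + s *\<^sub>R e)) (snd z)) =
    (\<lambda>z. \<integral>t. (indicator {0..} t * indicator {0..} (snd z - t)) * G (fst z + t *\<^sub>R e) \<partial>lborel)"
    unfolding indef_int_def fun_eq_iff
    by (auto intro!: Bochner_Integration.integral_cong simp: indicator_def)
  then show ?thesis by simp
qed

text \<open>Here \<open>\<phi> j\<close> is the value at the start of the segment, so
  \<open>\<phi> j + indef_int (a j) s\<close> is the value at parameter \<open>s\<close>. The
  equation may be integrated term by term because every product with an indefinite integral is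
  integrable.\<close>

lemma integral_contact_form:
  fixes a :: "nat \<Rightarrow> real \<Rightarrow> real" and \<phi> :: "nat \<Rightarrow> real"
  assumes [measurable]: "\<And>j. a j \<in> borel_measurable borel"
    and i: "\<And>j. integrable lborel (\<lambda>s. indicator {0..h} s * a j s)"
    and contact: "AE s in lborel. s \<in> {0..h} \<longrightarrow>
      a (2*n+1) s = (\<Sum>j=1..n. (\<phi> j + indef_int (a j) s) * a (j+n) s - (\<phi> (j+n) + indef_int (a (j+n)) s) * a j s)"
  shows "indef_int (a (2*n+1)) h = (\<Sum>j=1..n. \<phi> j * indef_int (a (j+n)) h - \<phi> (j+n) * indef_int (a j) h
     + (iter_int h (a j) (a (j+n)) - iter_int h (a (j+n)) (a j)))"
proof -
  let ?I = "\<lambda>s. indicator {0..h} s :: real"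
  let ?g = "\<lambda>j s. \<phi> j * (?I s * a (j+n) s) - \<phi> (j+n) * (?I s * a j s)
     + (?I s * (indef_int (a j) s * a (j+n) s) - ?I s * (indef_int (a (j+n)) s * a j s))"
  note ii = integrable_indef_int_mult[OF _ i i]
  have int1: "integrable lborel (\<lambda>s. \<phi> j * (?I s * a (j+n) s) - \<phi> (j+n) * (?I s * a j s))" for j
    using i by (intro Bochner_Integration.integrable_diff integrable_mult_right) auto
  have int2: "integrable lborel (\<lambda>s. ?I s * (indef_int (a j) s * a (j+n) s) - ?I s * (indef_int (a (j+n)) s * a j s))" for j
    using ii by (intro Bochner_Integration.integrable_diff) auto
  have "indef_int (a (2*n+1)) h = (\<integral>s. (\<Sum>j=1..n. ?g j s) \<partial>lborel)"
    unfolding indef_int_def[of "a (2*n+1)"]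
  proof (rule integral_cong_AE)
    show "AE s in lborel. ?I s * a (2*n+1) s = (\<Sum>j=1..n. ?g j s)"
      using contact
    proof eventually_elim
      case (elim s)
      show ?case
      proof (cases "s \<in> {0..h}")
        case True
        then show ?thesis
          using elim by (auto simp: algebra_simps intro!: sum.cong)
      qed simp
    qed
  qed measurable
  also have "\<dots> = (\<Sum>j=1..n. \<integral>s. ?g j s \<partial>lborel)"
    by (intro Bochner_Integration.integral_sum Bochner_Integration.integrable_add int1 int2)
  also have "\<dots> = (\<Sum>j=1..n. \<phi> j * indef_int (a (j+n)) h - \<phi> (j+n) * indef_int (a j) h
     + (iter_int h (a j) (a (j+n)) - iter_int h (a (j+n)) (a j)))"
  proof (rule sum.cong[OF refl])
    fix j
    have "(\<integral>s. ?g j s \<partial>lborel) = (\<integral>s. \<phi> j * (?I s * a (j+n) s) - \<phi> (j+n) * (?I s * a j s) \<partial>lborel)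
      + (\<integral>s. ?I s * (indef_int (a j) s * a (j+n) s) - ?I s * (indef_int (a (j+n)) s * a j s) \<partial>lborel)"
      by (rule Bochner_Integration.integral_add[OF int1 int2])
    also have "(\<integral>s. \<phi> j * (?I s * a (j+n) s) - \<phi> (j+n) * (?I s * a j s) \<partial>lborel) =
       \<phi> j * indef_int (a (j+n)) h - \<phi> (j+n) * indef_int (a j) h"
      unfolding indef_int_def integral_mult_right_zero[symmetric]
      by (intro Bochner_Integration.integral_diff integrable_mult_right i)
    also have "(\<integral>s. ?I s * (indef_int (a j) s * a (j+n) s) - ?I s * (indef_int (a (j+n)) s * a j s) \<partial>lborel) =
       iter_int h (a j) (a (j+n)) - iter_int h (a (j+n)) (a j)"
      unfolding iter_int_def by (intro Bochner_Integration.integral_diff ii) auto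
    finally show "(\<integral>s. ?g j s \<partial>lborel) = \<phi> j * indef_int (a (j+n)) h - \<phi> (j+n) * indef_int (a j) h
     + (iter_int h (a j) (a (j+n)) - iter_int h (a (j+n)) (a j))" .
  qed
  finally show ?thesis .
qed

text \<open>The increment formula is known for each fixed \<open>s\<close> outside a null set of
  \<open>y\<close> that depends on \<open>s\<close>. Fubini turns this into almost every
  \<open>s\<close> for almost every \<open>y\<close>, which is enough under an integral over
  \<open>s\<close>.\<close>

lemma AE_horizontal_segment:
  fixes F D :: "nat \<Rightarrow> 'a::euclidean_space \<Rightarrow> real" and e :: 'a
  assumes F: "\<And>j. integrable lborel (F j)" and D: "\<And>j. integrable lborel (D j)"
    and V[measurable]: "V \<in> sets borel" and K[measurable]: "K \<in> sets borel" and h: "h \<ge> 0"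
    and incr: "\<And>j s. j \<in> {1..2*n+1} \<Longrightarrow> 0 \<le> s \<Longrightarrow> s \<le> h \<Longrightarrow>
      AE y in lborel. y \<in> V \<longrightarrow> F j (y + s *\<^sub>R e) - F j y = indef_int (\<lambda>t. D j (y + t *\<^sub>R e)) s"
    and contact: "AE y in lborel. y \<in> K \<longrightarrow>
      D (2*n+1) y = (\<Sum>j=1..n. F j y * D (j+n) y - F (j+n) y * D j y)"
    and VK: "\<And>y s. y \<in> V \<Longrightarrow> 0 \<le> s \<Longrightarrow> s \<le> h \<Longrightarrow> y + s *\<^sub>R e \<in> K"
  shows "AE y in lborel. y \<in> V \<longrightarrow> horizontal_segment n F D e h y"
proof -
  have [measurable]: "F j \<in> borel_measurable borel" "D j \<in> borel_measurable borel" for j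
    using borel_measurable_integrable[OF F[of j]] borel_measurable_integrable[OF D[of j]] by simp_all
  have 1: "AE y in lborel. \<forall>j. integrable lborel (\<lambda>s. indicator {0..h} s * D j (y + s *\<^sub>R e))"
    unfolding AE_all_countable
    using lborel_pair.AE_integrable_fst'[OF integrable_pair_translate[OF D]] by simp
  \<comment> \<open>The endpoint needs its own statement: a formula valid for almost every
    \<open>s\<close> may fail at \<open>s = h\<close>.\<close>
  have 2: "AE y in lborel. \<forall>j\<in>{1..2*n+1}. y \<in> V \<longrightarrow>
      F j (y + h *\<^sub>R e) - F j y = indef_int (\<lambda>t. D j (y + t *\<^sub>R e)) h"
    using incr h by (intro AE_ball_countable') auto
  have 3: "AE y in lborel. \<forall>j\<in>{1..2*n+1}. AE s in lborel. y \<in> V \<longrightarrow> s \<in> {0..h} \<longrightarrow>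
      F j (y + s *\<^sub>R e) - F j y = indef_int (\<lambda>t. D j (y + t *\<^sub>R e)) s"
  proof (rule AE_ball_countable')
    fix j assume j: "j \<in> {1..2*n+1}"
    note [measurable] = borel_measurable_indef_int_pair[of "D j" e]
    have "AE s in lborel. AE y in lborel. y \<in> V \<longrightarrow> s \<in> {0..h} \<longrightarrow>
      F j (y + s *\<^sub>R e) - F j y = indef_int (\<lambda>t. D j (y + t *\<^sub>R e)) s"
    proof (rule AE_I2)
      fix s :: real
      show "AE y in lborel. y \<in> V \<longrightarrow> s \<in> {0..h} \<longrightarrow>
        F j (y + s *\<^sub>R e) - F j y = indef_int (\<lambda>t. D j (y + t *\<^sub>R e)) s"
        using incr[OF j, of s] by (cases "s \<in> {0..h}") auto
    qed
    then show "AE y in lborel. AE s in lborel. y \<in> V \<longrightarrow> s \<in> {0..h} \<longrightarrow>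
      F j (y + s *\<^sub>R e) - F j y = indef_int (\<lambda>t. D j (y + t *\<^sub>R e)) s"
      by (subst lborel_pair.AE_commute) measurable
  qed auto
  \<comment> \<open>Each translate of the null set where the contact equation fails is again null;
    Fubini then shows that almost every segment meets that set in a null set of parameters.\<close>
  have 4: "AE y in lborel. AE s in lborel. y + s *\<^sub>R e \<in> K \<longrightarrow>
      D (2*n+1) (y + s *\<^sub>R e) = (\<Sum>j=1..n. F j (y + s *\<^sub>R e) * D (j+n) (y + s *\<^sub>R e) - F (j+n) (y + s *\<^sub>R e) * D j (y + s *\<^sub>R e))"
  proof -
    have "AE s in lborel. AE y in lborel. y + s *\<^sub>R e \<in> K \<longrightarrow>
      D (2*n+1) (y + s *\<^sub>R e) = (\<Sum>j=1..n. F j (y + s *\<^sub>R e) * D (j+n) (y + s *\<^sub>R e) - F (j+n) (y + s *\<^sub>R e) * D j (y + s *\<^sub>R e))"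
      by (rule AE_I2, rule AE_lborel_translate[OF contact])
    then show ?thesis
      by (subst lborel_pair.AE_commute) measurable
  qed
  show ?thesis
    using 1 2 3 4
  proof eventually_elim
    case (elim y)
    show ?case
    proof
      assume y: "y \<in> V"
      define a where "a = (\<lambda>j s. D j (y + s *\<^sub>R e))"
      have [measurable]: "a j \<in> borel_measurable borel" for j by (simp add: a_def)
      have i: "integrable lborel (\<lambda>s. indicator {0..h} s * a j s)" for j
        using elim(1) by (simp add: a_def)
      have inc: "F j (y + h *\<^sub>R e) = F j y + indef_int (a j) h" if "j \<in> {1..2*n+1}" for j
        using bspec[OF elim(2) that] y by (simp add: a_def)
      have Fs: "AE s in lborel. \<forall>j\<in>{1..2*n+1}. s \<in> {0..h} \<longrightarrow> F j (y + s *\<^sub>R e) = F j y + indef_int (a j) s"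
      proof (rule AE_ball_countable')
        fix j assume "j \<in> {1..2*n+1}"
        with elim(3) have "AE s in lborel. y \<in> V \<longrightarrow> s \<in> {0..h} \<longrightarrow>
          F j (y + s *\<^sub>R e) - F j y = indef_int (\<lambda>t. D j (y + t *\<^sub>R e)) s" by blast
        then show "AE s in lborel. s \<in> {0..h} \<longrightarrow> F j (y + s *\<^sub>R e) = F j y + indef_int (a j) s"
          by eventually_elim (use y in \<open>auto simp: a_def\<close>)
      qed auto
      have "AE s in lborel. s \<in> {0..h} \<longrightarrow>
        a (2*n+1) s = (\<Sum>j=1..n. (F j y + indef_int (a j) s) * a (j+n) s - (F (j+n) y + indef_int (a (j+n)) s) * a j s)"
        using Fs elim(4)
      proof eventually_elim
        case (elim s)
        show ?case
        proof
          assume s: "s \<in> {0..h}"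
          then have "y + s *\<^sub>R e \<in> K" using VK[OF y] by simp
          then have "a (2*n+1) s = (\<Sum>j=1..n. F j (y + s *\<^sub>R e) * a (j+n) s - F (j+n) (y + s *\<^sub>R e) * a j s)"
            using elim(2) by (simp add: a_def)
          also have "\<dots> = (\<Sum>j=1..n. (F j y + indef_int (a j) s) * a (j+n) s - (F (j+n) y + indef_int (a (j+n)) s) * a j s)"
            using elim(1) s by (intro sum.cong) auto
          finally show "a (2*n+1) s = \<dots>" .
        qed
      qed
      from integral_contact_form[OF _ i this]
      have "indef_int (a (2*n+1)) h = (\<Sum>j=1..n. F j y * indef_int (a (j+n)) h - F (j+n) y * indef_int (a j) h
        + (iter_int h (a j) (a (j+n)) - iter_int h (a (j+n)) (a j)))"
        by simp
      with i inc show "horizontal_segment n F D e h y"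
        unfolding horizontal_segment_def a_def[symmetric] by (simp add: Let_def)
    qed
  qed
qed

lemma horizontal_segmentD:
  assumes "horizontal_segment n F D e h y" and a: "a = (\<lambda>j s. D j (y + s *\<^sub>R e))"
  shows "integrable lborel (\<lambda>s. indicator {0..h} s * a j s)"
    and "j \<in> {1..2*n+1} \<Longrightarrow> F j (y + h *\<^sub>R e) = F j y + indef_int (a j) h"
    and "F (2*n+1) (y + h *\<^sub>R e) - F (2*n+1) y =
       (\<Sum>j=1..n. F j y * indef_int (a (j+n)) h - F (j+n) y * indef_int (a j) h
          + (iter_int h (a j) (a (j+n)) - iter_int h (a (j+n)) (a j)))"
  using assms(1) unfolding horizontal_segment_def a[symmetric] Let_def by blast+

text \<open>The four increments of the last component, with signs, add up to zero. Referring the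
  values at the intermediate corners back to \<open>x\<close> produces the cross terms of
  increments, and all terms containing the values at \<open>x\<close> cancel.\<close>

lemma horizontal_square:
  fixes F :: "nat \<Rightarrow> 'a::euclidean_space \<Rightarrow> real" and D D' :: "nat \<Rightarrow> 'a \<Rightarrow> real" and e e' x :: 'a
  assumes "horizontal_segment n F D e h x" "horizontal_segment n F D' e' h (x + h *\<^sub>R e)"
    and "horizontal_segment n F D e h (x + h *\<^sub>R e')" "horizontal_segment n F D' e' h x"
  defines "a \<equiv> \<lambda>j s. D j (x + s *\<^sub>R e)" and "b \<equiv> \<lambda>j s. D' j (x + h *\<^sub>R e + s *\<^sub>R e')"
    and "c \<equiv> \<lambda>j s. D j (x + h *\<^sub>R e' + s *\<^sub>R e)" and "d \<equiv> \<lambda>j s. D' j (x + s *\<^sub>R e')"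
  shows "(\<Sum>j=1..n. (iter_int h (a j) (a (j+n)) - iter_int h (a (j+n)) (a j))
      + (iter_int h (b j) (b (j+n)) - iter_int h (b (j+n)) (b j))
      - (iter_int h (c j) (c (j+n)) - iter_int h (c (j+n)) (c j))
      - (iter_int h (d j) (d (j+n)) - iter_int h (d (j+n)) (d j))
      + indef_int (a j) h * indef_int (b (j+n)) h - indef_int (a (j+n)) h * indef_int (b j) h
      - indef_int (d j) h * indef_int (c (j+n)) h + indef_int (d (j+n)) h * indef_int (c j) h) = 0"
proof -
  define I where "I u j = iter_int h (u j) (u (j+n)) - iter_int h (u (j+n)) (u j)" for u :: "nat \<Rightarrow> real \<Rightarrow> real" and j
  define P where "P u j = indef_int (u j) h" for u :: "nat \<Rightarrow> real \<Rightarrow> real" and j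
  define z where "z j = F j x" for j
  have corner: "x + h *\<^sub>R e' + h *\<^sub>R e = x + h *\<^sub>R e + h *\<^sub>R e'" by (simp add: add_ac)
  note sa = horizontal_segmentD(2,3)[OF assms(1), of a, OF a_def[THEN meta_eq_to_obj_eq], folded I_def P_def z_def]
    and sb = horizontal_segmentD(2,3)[OF assms(2), of b, OF b_def[THEN meta_eq_to_obj_eq], folded I_def P_def]
    and sc = horizontal_segmentD(2,3)[OF assms(3), of c, OF c_def[THEN meta_eq_to_obj_eq], folded I_def P_def]
    and sd = horizontal_segmentD(2,3)[OF assms(4), of d, OF d_def[THEN meta_eq_to_obj_eq], folded I_def P_def z_def]
  have J: "j \<in> {1..2*n+1}" "j + n \<in> {1..2*n+1}" if "j \<in> {1..n}" for j
    using that by auto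
  have A: "F j (x + h *\<^sub>R e) = z j + P a j" and B: "F j (x + h *\<^sub>R e + h *\<^sub>R e') = F j (x + h *\<^sub>R e) + P b j"
    and C: "F j (x + h *\<^sub>R e + h *\<^sub>R e') = F j (x + h *\<^sub>R e') + P c j" and D: "F j (x + h *\<^sub>R e') = z j + P d j"
    if "j \<in> {1..2*n+1}" for j
    using sa(1)[OF that] sb(1)[OF that] sc(1)[OF that] sd(1)[OF that] unfolding corner by auto
  \<comment> \<open>Every component returns to its initial value after one round. This makes the
    coefficient of each \<open>z j\<close> vanish exactly, not merely in the limit.\<close>
  have closed: "P b j = P d j + P c j - P a j" if "j \<in> {1..2*n+1}" for j
    using A[OF that] B[OF that] C[OF that] D[OF that] by linarith
  let ?N = "2*n+1"
  have eA: "F ?N (x + h *\<^sub>R e) - z ?N = (\<Sum>j=1..n. z j * P a (j+n) - z (j+n) * P a j + I a j)"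
    by (rule sa(2))
  have eD: "F ?N (x + h *\<^sub>R e') - z ?N = (\<Sum>j=1..n. z j * P d (j+n) - z (j+n) * P d j + I d j)"
    by (rule sd(2))
  have eB: "F ?N (x + h *\<^sub>R e + h *\<^sub>R e') - F ?N (x + h *\<^sub>R e) =
      (\<Sum>j=1..n. (z j + P a j) * P b (j+n) - (z (j+n) + P a (j+n)) * P b j + I b j)"
  proof -
    have "F ?N (x + h *\<^sub>R e + h *\<^sub>R e') - F ?N (x + h *\<^sub>R e) =
      (\<Sum>j=1..n. F j (x + h *\<^sub>R e) * P b (j+n) - F (j+n) (x + h *\<^sub>R e) * P b j + I b j)"
      by (rule sb(2))
    also have "\<dots> = (\<Sum>j=1..n. (z j + P a j) * P b (j+n) - (z (j+n) + P a (j+n)) * P b j + I b j)"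
      using A J by (intro sum.cong refl) simp
    finally show ?thesis .
  qed
  have eC: "F ?N (x + h *\<^sub>R e + h *\<^sub>R e') - F ?N (x + h *\<^sub>R e') =
      (\<Sum>j=1..n. (z j + P d j) * P c (j+n) - (z (j+n) + P d (j+n)) * P c j + I c j)"
  proof -
    have "F ?N (x + h *\<^sub>R e + h *\<^sub>R e') - F ?N (x + h *\<^sub>R e') =
      (\<Sum>j=1..n. F j (x + h *\<^sub>R e') * P c (j+n) - F (j+n) (x + h *\<^sub>R e') * P c j + I c j)"
      using sc(2) unfolding corner .
    also have "\<dots> = (\<Sum>j=1..n. (z j + P d j) * P c (j+n) - (z (j+n) + P d (j+n)) * P c j + I c j)"
      using D J by (intro sum.cong refl) simp
    finally show ?thesis .
  qed
  have "(\<Sum>j=1..n. I a j + I b j - I c j - I d j + P a j * P b (j+n) - P a (j+n) * P b j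
      - P d j * P c (j+n) + P d (j+n) * P c j) =
    (\<Sum>j=1..n. (z j * P a (j+n) - z (j+n) * P a j + I a j)
      + ((z j + P a j) * P b (j+n) - (z (j+n) + P a (j+n)) * P b j + I b j)
      - ((z j + P d j) * P c (j+n) - (z (j+n) + P d (j+n)) * P c j + I c j)
      - (z j * P d (j+n) - z (j+n) * P d j + I d j))"
    by (intro sum.cong refl, simp only: closed[OF J(1)] closed[OF J(2)]) (simp add: algebra_simps)
  also have "\<dots> = 0"
    unfolding sum.distrib sum_subtractf[of _ _ "{1..n}"]
    using eA eB eC eD by (simp add: sum.distrib sum_subtractf)
  finally show ?thesis by (simp add: I_def P_def)
qed

text \<open>After division by \<open>(h m)\<^sup>2\<close> the Levy areas tend to zero one by one,
  by symmetry of the limit of \<open>iter_int\<close>. The cross terms of the two paths to the far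
  corner have opposite limits and enter with opposite signs, so they add up to twice the sum in
  question.\<close>

lemma horizontal_squares_limit:
  fixes F :: "nat \<Rightarrow> 'a::euclidean_space \<Rightarrow> real" and D :: "nat \<Rightarrow> 'a \<Rightarrow> real" and D' :: "nat \<Rightarrow> 'a \<Rightarrow> real" and e e' x :: 'a
  assumes [measurable]: "\<And>j. D j \<in> borel_measurable borel" "\<And>j. D' j \<in> borel_measurable borel"
    and h: "\<And>n::nat. h n > 0"
    and seg: "\<And>m. horizontal_segment n F D e (h m) x" "\<And>m. horizontal_segment n F D' e' (h m) (x + h m *\<^sub>R e)"
      "\<And>m. horizontal_segment n F D e (h m) (x + h m *\<^sub>R e')" "\<And>m. horizontal_segment n F D' e' (h m) x"
    and la: "\<And>j. j \<in> {1..2*n} \<Longrightarrow> (\<lambda>m. (\<integral>s. indicator {0..h m} s * \<bar>D j (x + s *\<^sub>R e) - D j x\<bar> \<partial>lborel) / h m) \<longlonglongrightarrow> 0"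
    and lb: "\<And>j. j \<in> {1..2*n} \<Longrightarrow> (\<lambda>m. (\<integral>s. indicator {0..h m} s * \<bar>D' j (x + h m *\<^sub>R e + s *\<^sub>R e') - D' j x\<bar> \<partial>lborel) / h m) \<longlonglongrightarrow> 0"
    and lc: "\<And>j. j \<in> {1..2*n} \<Longrightarrow> (\<lambda>m. (\<integral>s. indicator {0..h m} s * \<bar>D j (x + h m *\<^sub>R e' + s *\<^sub>R e) - D j x\<bar> \<partial>lborel) / h m) \<longlonglongrightarrow> 0"
    and ld: "\<And>j. j \<in> {1..2*n} \<Longrightarrow> (\<lambda>m. (\<integral>s. indicator {0..h m} s * \<bar>D' j (x + s *\<^sub>R e') - D' j x\<bar> \<partial>lborel) / h m) \<longlonglongrightarrow> 0"
  shows "(\<Sum>j=1..n. D j x * D' (j+n) x - D' j x * D (j+n) x) = 0"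
proof -
  define a where "a = (\<lambda>(m::nat) j s. D j (x + s *\<^sub>R e))"
  define b where "b = (\<lambda>m j s. D' j (x + h m *\<^sub>R e + s *\<^sub>R e'))"
  define c where "c = (\<lambda>m j s. D j (x + h m *\<^sub>R e' + s *\<^sub>R e))"
  define d where "d = (\<lambda>(m::nat) j s. D' j (x + s *\<^sub>R e'))"
  have [measurable]: "a m j \<in> borel_measurable borel" "b m j \<in> borel_measurable borel"
    "c m j \<in> borel_measurable borel" "d m j \<in> borel_measurable borel" for m j
    by (simp_all add: a_def b_def c_def d_def)
  have int: "integrable lborel (\<lambda>s. indicator {0..h m} s * a m j s)"
    "integrable lborel (\<lambda>s. indicator {0..h m} s * b m j s)"
    "integrable lborel (\<lambda>s. indicator {0..h m} s * c m j s)"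
    "integrable lborel (\<lambda>s. indicator {0..h m} s * d m j s)" for m j
    by (rule horizontal_segmentD(1)[OF seg(1)] horizontal_segmentD(1)[OF seg(2)]
        horizontal_segmentD(1)[OF seg(3)] horizontal_segmentD(1)[OF seg(4)];
        simp add: a_def b_def c_def d_def)+
  have lim: "(\<lambda>m. (\<integral>s. indicator {0..h m} s * \<bar>a m j s - D j x\<bar> \<partial>lborel) / h m) \<longlonglongrightarrow> 0"
    "(\<lambda>m. (\<integral>s. indicator {0..h m} s * \<bar>b m j s - D' j x\<bar> \<partial>lborel) / h m) \<longlonglongrightarrow> 0"
    "(\<lambda>m. (\<integral>s. indicator {0..h m} s * \<bar>c m j s - D j x\<bar> \<partial>lborel) / h m) \<longlonglongrightarrow> 0"
    "(\<lambda>m. (\<integral>s. indicator {0..h m} s * \<bar>d m j s - D' j x\<bar> \<partial>lborel) / h m) \<longlonglongrightarrow> 0"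
    if "j \<in> {1..2*n}" for j
    unfolding a_def b_def c_def d_def by (rule la lb lc ld, rule that)+
  have J: "j \<in> {1..2*n}" "j + n \<in> {1..2*n}" if "j \<in> {1..n}" for j
    using that by auto
  have mean: "(\<lambda>m. indef_int (a m j) (h m) / h m) \<longlonglongrightarrow> D j x"
    "(\<lambda>m. indef_int (b m j) (h m) / h m) \<longlonglongrightarrow> D' j x"
    "(\<lambda>m. indef_int (c m j) (h m) / h m) \<longlonglongrightarrow> D j x"
    "(\<lambda>m. indef_int (d m j) (h m) / h m) \<longlonglongrightarrow> D' j x" if "j \<in> {1..2*n}" for j
    using lim[OF that] by (auto intro!: indef_int_mean_tendsto h int)
  have iter: "(\<lambda>m. iter_int (h m) (a m j) (a m i) / (h m)\<^sup>2) \<longlonglongrightarrow> D j x * D i x / 2"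
    "(\<lambda>m. iter_int (h m) (b m j) (b m i) / (h m)\<^sup>2) \<longlonglongrightarrow> D' j x * D' i x / 2"
    "(\<lambda>m. iter_int (h m) (c m j) (c m i) / (h m)\<^sup>2) \<longlonglongrightarrow> D j x * D i x / 2"
    "(\<lambda>m. iter_int (h m) (d m j) (d m i) / (h m)\<^sup>2) \<longlonglongrightarrow> D' j x * D' i x / 2"
    if "j \<in> {1..2*n}" "i \<in> {1..2*n}" for j i
    unfolding iter_int_def
    using lim[OF that(1)] lim[OF that(2)] by (auto intro!: indef_int_mult_mean_tendsto h int)
  let ?T = "\<lambda>m j. (iter_int (h m) (a m j) (a m (j+n)) / (h m)\<^sup>2 - iter_int (h m) (a m (j+n)) (a m j) / (h m)\<^sup>2)
      + (iter_int (h m) (b m j) (b m (j+n)) / (h m)\<^sup>2 - iter_int (h m) (b m (j+n)) (b m j) / (h m)\<^sup>2)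
      - (iter_int (h m) (c m j) (c m (j+n)) / (h m)\<^sup>2 - iter_int (h m) (c m (j+n)) (c m j) / (h m)\<^sup>2)
      - (iter_int (h m) (d m j) (d m (j+n)) / (h m)\<^sup>2 - iter_int (h m) (d m (j+n)) (d m j) / (h m)\<^sup>2)
      + indef_int (a m j) (h m) / h m * (indef_int (b m (j+n)) (h m) / h m) - indef_int (a m (j+n)) (h m) / h m * (indef_int (b m j) (h m) / h m)
      - indef_int (d m j) (h m) / h m * (indef_int (c m (j+n)) (h m) / h m) + indef_int (d m (j+n)) (h m) / h m * (indef_int (c m j) (h m) / h m)"
  have "(\<lambda>m. \<Sum>j=1..n. ?T m j) \<longlonglongrightarrow> (\<Sum>j=1..n.
      (D j x * D (j+n) x / 2 - D (j+n) x * D j x / 2)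
      + (D' j x * D' (j+n) x / 2 - D' (j+n) x * D' j x / 2)
      - (D j x * D (j+n) x / 2 - D (j+n) x * D j x / 2)
      - (D' j x * D' (j+n) x / 2 - D' (j+n) x * D' j x / 2)
      + D j x * D' (j+n) x - D (j+n) x * D' j x - D' j x * D (j+n) x + D' (j+n) x * D j x)"
    by (intro tendsto_sum tendsto_add tendsto_diff tendsto_mult iter mean J)
  moreover have "(\<Sum>j=1..n. ?T m j) = 0" for m
  proof -
    have "(\<Sum>j=1..n. ?T m j) = (\<Sum>j=1..n. (iter_int (h m) (a m j) (a m (j+n)) - iter_int (h m) (a m (j+n)) (a m j))
      + (iter_int (h m) (b m j) (b m (j+n)) - iter_int (h m) (b m (j+n)) (b m j))
      - (iter_int (h m) (c m j) (c m (j+n)) - iter_int (h m) (c m (j+n)) (c m j))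
      - (iter_int (h m) (d m j) (d m (j+n)) - iter_int (h m) (d m (j+n)) (d m j))
      + indef_int (a m j) (h m) * indef_int (b m (j+n)) (h m) - indef_int (a m (j+n)) (h m) * indef_int (b m j) (h m)
      - indef_int (d m j) (h m) * indef_int (c m (j+n)) (h m) + indef_int (d m (j+n)) (h m) * indef_int (c m j) (h m)) / (h m)\<^sup>2"
      unfolding sum_divide_distrib
      by (intro sum.cong refl) (simp add: add_divide_distrib diff_divide_distrib power2_eq_square)
    also have "\<dots> = 0"
      using horizontal_square[OF seg(1-4)[of m]] unfolding a_def b_def c_def d_def by simp
    finally show ?thesis .
  qed
  ultimately have "(\<Sum>j=1..n.
      (D j x * D (j+n) x / 2 - D (j+n) x * D j x / 2)
      + (D' j x * D' (j+n) x / 2 - D' (j+n) x * D' j x / 2)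
      - (D j x * D (j+n) x / 2 - D (j+n) x * D j x / 2)
      - (D' j x * D' (j+n) x / 2 - D' (j+n) x * D' j x / 2)
      + D j x * D' (j+n) x - D (j+n) x * D' j x - D' j x * D (j+n) x + D' (j+n) x * D j x) = 0"
    by (simp add: LIMSEQ_const_iff)
  also have "(\<Sum>j=1..n.
      (D j x * D (j+n) x / 2 - D (j+n) x * D j x / 2)
      + (D' j x * D' (j+n) x / 2 - D' (j+n) x * D' j x / 2)
      - (D j x * D (j+n) x / 2 - D (j+n) x * D j x / 2)
      - (D' j x * D' (j+n) x / 2 - D' (j+n) x * D' j x / 2)
      + D j x * D' (j+n) x - D (j+n) x * D' j x - D' j x * D (j+n) x + D' (j+n) x * D j x)
    = 2 * (\<Sum>j=1..n. D j x * D' (j+n) x - D' j x * D (j+n) x)"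
    unfolding sum_distrib_left by (intro sum.cong refl) (simp add: algebra_simps)
  finally show ?thesis by simp
qed

text \<open>
  In the index \<open>(j, p, q)\<close> of the four families of sides, \<open>p\<close> selects the direction and \<open>q\<close> tells
  whether the side is the one that does not contain \<open>x\<close>.
\<close>
lemma AE_horizontal_imp_isotropic:
  fixes F :: "nat \<Rightarrow> 'a::euclidean_space \<Rightarrow> real" and D D' :: "nat \<Rightarrow> 'a \<Rightarrow> real" and e e' :: 'a
  assumes D: "\<And>j. integrable lborel (D j)" "\<And>j. integrable lborel (D' j)" and r: "r > 0"
    and seg: "\<And>h. 0 < h \<Longrightarrow> h \<le> r \<Longrightarrow> AE y in lborel. y \<in> V \<longrightarrow> horizontal_segment n F D e h y"
      "\<And>h. 0 < h \<Longrightarrow> h \<le> r \<Longrightarrow> AE y in lborel. y \<in> V \<longrightarrow> horizontal_segment n F D' e' h y"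
    and WV: "\<And>x h. x \<in> W \<Longrightarrow> 0 \<le> h \<Longrightarrow> h \<le> r \<Longrightarrow> x + h *\<^sub>R e \<in> V \<and> x + h *\<^sub>R e' \<in> V"
  shows "AE x in lborel. x \<in> W \<longrightarrow> (\<Sum>j=1..n. D j x * D' (j+n) x - D' j x * D (j+n) x) = 0"
proof -
  have [measurable]: "D j \<in> borel_measurable borel" "D' j \<in> borel_measurable borel" for j
    using borel_measurable_integrable[OF D(1)[of j]] borel_measurable_integrable[OF D(2)[of j]] by simp_all
  \<comment> \<open>The exceptional null set depends on the side length, so only countably many
    lengths may be used.\<close>
  define h where "h m = r / real (Suc m)" for m
  have h: "h m > 0" "h m \<le> r" for m
    using r by (auto simp: h_def field_simps)
  have h0: "h \<longlonglongrightarrow> 0"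
    using tendsto_mult[OF tendsto_const[of r] LIMSEQ_Suc[OF lim_1_over_n]] by (simp add: h_def[abs_def])
  have h0v: "(\<lambda>m. h m *\<^sub>R v) \<longlonglongrightarrow> 0" for v :: 'a
    using tendsto_scaleR[OF h0 tendsto_const[of v]] by simp
  define S where "S = {1..2*n} \<times> (UNIV :: (bool \<times> bool) set)"
  define G where "G = (\<lambda>(j, p, q::bool). if p then D j else D' j)"
  define c where "c = (\<lambda>(j::nat, p, q) m. if q then h m *\<^sub>R (if p then e' else e) else 0)"
  define u where "u = (\<lambda>(j::nat, p, q::bool). if p then e else e')"
  obtain \<rho> where \<rho>: "strict_mono \<rho>" and ae: "AE x in lborel. \<forall>i\<in>S. (\<lambda>m. (\<integral>s. indicator {0..h (\<rho> m)} s *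
      \<bar>G i (x + c i (\<rho> m) + s *\<^sub>R u i) - G i x\<bar> \<partial>lborel) / h (\<rho> m)) \<longlonglongrightarrow> 0"
  proof (rule segment_averages_subseq[of S G h c u])
    show "finite S" by (simp add: S_def)
    show "integrable lborel (G i)" for i using D by (auto simp: G_def split: prod.splits)
    show "c i \<longlonglongrightarrow> 0" for i using h0v by (cases i; cases "snd (snd i)") (auto simp: c_def)
  qed (use h h0 in auto)
  \<comment> \<open>The two sides away from \<open>x\<close> start at
    \<open>x + h m *\<^sub>R e\<close> and \<open>x + h m *\<^sub>R e'\<close>; their exceptional
    sets are translates of null sets.\<close>
  have "AE x in lborel. \<forall>m. (x \<in> V \<longrightarrow> horizontal_segment n F D e (h m) x) \<and>
     (x \<in> V \<longrightarrow> horizontal_segment n F D' e' (h m) x) \<and>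
     (x + h m *\<^sub>R e \<in> V \<longrightarrow> horizontal_segment n F D' e' (h m) (x + h m *\<^sub>R e)) \<and>
     (x + h m *\<^sub>R e' \<in> V \<longrightarrow> horizontal_segment n F D e (h m) (x + h m *\<^sub>R e'))"
    unfolding AE_all_countable
    by (intro allI AE_conjI seg h AE_lborel_translate[where P = "\<lambda>y. y \<in> V \<longrightarrow> horizontal_segment n F D e (h _) y"]
       AE_lborel_translate[where P = "\<lambda>y. y \<in> V \<longrightarrow> horizontal_segment n F D' e' (h _) y"])
  then show ?thesis
    using ae
  proof eventually_elim
    case (elim x)
    show ?case
    proof
      assume x: "x \<in> W"
      have "x \<in> V" using WV[OF x, of 0] r by simp
      have V: "x + h m *\<^sub>R e \<in> V" "x + h m *\<^sub>R e' \<in> V" for m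
        using WV[OF x, of "h m"] h[of m] by auto
      have lim: "(\<lambda>m. (\<integral>s. indicator {0..h (\<rho> m)} s *
        \<bar>G (j, p, q) (x + c (j, p, q) (\<rho> m) + s *\<^sub>R u (j, p, q)) - G (j, p, q) x\<bar> \<partial>lborel) / h (\<rho> m)) \<longlonglongrightarrow> 0"
        if "j \<in> {1..2*n}" for j p q
        using bspec[OF elim(2), of "(j, p, q)"] that by (simp add: S_def)
      show "(\<Sum>j=1..n. D j x * D' (j+n) x - D' j x * D (j+n) x) = 0"
      proof (rule horizontal_squares_limit[where h = "\<lambda>m. h (\<rho> m)" and F = F and e = e and e' = e'])
        fix j assume j: "j \<in> {1..2*n}"
        show "(\<lambda>m. (\<integral>s. indicator {0..h (\<rho> m)} s * \<bar>D j (x + s *\<^sub>R e) - D j x\<bar> \<partial>lborel) / h (\<rho> m)) \<longlonglongrightarrow> 0"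
          using lim[OF j, of True False] by (simp add: G_def c_def u_def)
        show "(\<lambda>m. (\<integral>s. indicator {0..h (\<rho> m)} s * \<bar>D' j (x + h (\<rho> m) *\<^sub>R e + s *\<^sub>R e') - D' j x\<bar> \<partial>lborel) / h (\<rho> m)) \<longlonglongrightarrow> 0"
          using lim[OF j, of False True] by (simp add: G_def c_def u_def)
        show "(\<lambda>m. (\<integral>s. indicator {0..h (\<rho> m)} s * \<bar>D j (x + h (\<rho> m) *\<^sub>R e' + s *\<^sub>R e) - D j x\<bar> \<partial>lborel) / h (\<rho> m)) \<longlonglongrightarrow> 0"
          using lim[OF j, of True True] by (simp add: G_def c_def u_def)
        show "(\<lambda>m. (\<integral>s. indicator {0..h (\<rho> m)} s * \<bar>D' j (x + s *\<^sub>R e') - D' j x\<bar> \<partial>lborel) / h (\<rho> m)) \<longlonglongrightarrow> 0"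
          using lim[OF j, of False False] by (simp add: G_def c_def u_def)
      qed (use elim(1) \<open>x \<in> V\<close> V h in auto)
    qed
  qed
qed

section \<open>Borel representatives, cubes and localisation\<close>

text \<open>Extension by zero outside \<open>K\<close>, changed on a null set to become Borel.
  Global integrability on \<open>lborel\<close> is the setting of the Fubini and translation
  arguments, whereas \<open>u\<close> is only Lebesgue measurable on compact subsets.\<close>

lemma L1_loc_borel_representative:
  fixes \<Omega> :: "(real^'m::finite) set"
  assumes "L1_loc \<Omega> u" "compact K" "K \<subseteq> \<Omega>"
  obtains U where "integrable lborel U" "AE x in lborel. x \<in> K \<longrightarrow> U x = u x"
proof -
  have "u absolutely_integrable_on K"
    using assms by (auto simp: L1_loc_def)
  then have i: "integrable lebesgue (\<lambda>x. indicator K x *\<^sub>R u x)"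
    by (simp add: set_integrable_def)
  obtain U where U[measurable]: "U \<in> borel_measurable lborel"
    and ae: "AE x in lborel. indicator K x *\<^sub>R u x = U x"
    using completion_ex_borel_measurable_real[OF borel_measurable_integrable[OF i]] by blast
  have "integrable lebesgue U"
    using i AE_completion[OF ae]
    by (subst integrable_cong_AE[of _ _ "\<lambda>x. indicator K x *\<^sub>R u x"])
       (auto intro: borel_measurable_integrable measurable_completion)
  then have "integrable lborel U"
    by (simp add: integrable_completion)
  moreover have "AE x in lborel. x \<in> K \<longrightarrow> U x = u x"
    using ae by eventually_elim auto
  ultimately show ?thesis using that by blast
qed

definition cube :: "real^'m::finite \<Rightarrow> real \<Rightarrow> (real^'m) set" where
  "cube x r = {y. \<forall>i. \<bar>y $ i - x $ i\<bar> < r}"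

lemma cube_eq_box: "cube x r = box (x - vec r) (x + vec r)"
  by (auto simp: cube_def mem_box_cart abs_less_iff algebra_simps)

lemma cube_add_axis:
  assumes "y \<in> cube x r" "0 \<le> h" "h \<le> t"
  shows "y + h *\<^sub>R axis k 1 \<in> cube x (r + t)"
proof -
  have "\<bar>(y + h *\<^sub>R axis k 1) $ i - x $ i\<bar> < r + t" for i
  proof -
    have "\<bar>y $ i - x $ i\<bar> < r" using assms(1) by (simp add: cube_def)
    then show ?thesis using assms(2,3) by (auto simp: axis_def)
  qed
  then show ?thesis by (simp add: cube_def)
qed

lemma open_contains_closed_cube:
  fixes \<Omega> :: "(real^'m::finite) set"
  assumes "open \<Omega>" "x \<in> \<Omega>"
  obtains r where "r > 0" "cbox (x - vec r) (x + vec r) \<subseteq> \<Omega>"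
proof -
  obtain d where d: "d > 0" "ball x d \<subseteq> \<Omega>"
    using assms by (meson open_contains_ball)
  \<comment> \<open>The Euclidean norm is at most the sum of the coordinates' absolute values, here
    at most \<open>CARD('m)\<close> times \<open>r\<close>, that is \<open>d / 2\<close>.\<close>
  define r where "r = d / (2 * real CARD('m))"
  have r: "r > 0" using d by (simp add: r_def)
  have "cbox (x - vec r) (x + vec r) \<subseteq> ball x d"
  proof
    fix y assume "y \<in> cbox (x - vec r) (x + vec r)"
    then have "\<bar>(y - x) $ i\<bar> \<le> r" for i
      by (auto simp: mem_box_cart abs_le_iff algebra_simps)
    then have "norm (y - x) \<le> (\<Sum>i\<in>(UNIV :: 'm set). r)"
      by (intro order.trans[OF norm_le_l1_cart] sum_mono)
    also have "\<dots> < d" using d by (simp add: r_def)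
    finally show "y \<in> ball x d" by (simp add: dist_norm norm_minus_commute)
  qed
  then show ?thesis using that r d by blast
qed

theorem theorem5p1:
  fixes \<Omega> :: "(real^'m::finite) set"
    and n :: nat
    and f :: "nat \<Rightarrow> real^'m \<Rightarrow> real"
    and Df :: "nat \<Rightarrow> 'm \<Rightarrow> real^'m \<Rightarrow> real"
  assumes m2: "CARD('m) \<ge> 2"
    and op: "open \<Omega>"
    and sob: "\<forall>j\<in>{1..2*n+1}. W11_loc \<Omega> (f j)"
    and Dweak: "\<forall>j\<in>{1..2*n+1}. \<forall>k. weak_partial \<Omega> (f j) k (Df j k)"
    and contact: "AE x in lebesgue. x \<in> \<Omega> \<longrightarrow>
        (\<forall>k. Df (2*n+1) k x = (\<Sum>j=1..n. f j x * Df (j+n) k x - f (j+n) x * Df j k x))"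
  shows "AE x in lebesgue. x \<in> \<Omega> \<longrightarrow>
        (\<forall>k l. (\<Sum>j=1..n. Df j k x * Df (j+n) l x - Df j l x * Df (j+n) k x) = 0)"
proof -
  let ?J = "{1..2*n+1}"
  let ?P = "\<lambda>x. \<forall>k l. (\<Sum>j=1..n. Df j k x * Df (j+n) l x - Df j l x * Df (j+n) k x) = 0"
  have contact': "AE x in lborel. x \<in> \<Omega> \<longrightarrow>
        (\<forall>k. Df (2*n+1) k x = (\<Sum>j=1..n. f j x * Df (j+n) k x - f (j+n) x * Df j k x))"
    using contact by (simp add: AE_completion_iff)
  have local: "\<exists>W. open W \<and> x0 \<in> W \<and> (AE x in lborel. x \<in> W \<longrightarrow> ?P x)" if x0: "x0 \<in> \<Omega>" for x0
  proof -
    obtain R where R: "R > 0" and K\<Omega>: "cbox (x0 - vec R) (x0 + vec R) \<subseteq> \<Omega>"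
      using open_contains_closed_cube[OF op x0] by blast
    \<comment> \<open>Side lengths up to \<open>r\<close> carry \<open>W\<close>, of half-width
      \<open>r\<close>, into \<open>V\<close>, of half-width \<open>2 * r\<close>. Segments of
      length at most \<open>r\<close> from \<open>V\<close> then stay in \<open>K\<close>, of
      half-width \<open>4 * r\<close>.\<close>
    define r where "r = R / 4"
    have r: "r > 0" using R by (simp add: r_def)
    define K where "K = cbox (x0 - vec R) (x0 + vec R)"
    define V where "V = cube x0 (2 * r)"
    define W where "W = cube x0 r"
    have K: "compact K" "K \<subseteq> \<Omega>" "K \<in> sets borel" using K\<Omega> by (simp_all add: K_def)
    have Vm: "V \<in> sets borel" by (simp add: V_def cube_eq_box)
    have cubeK: "cube x0 R \<subseteq> K"
      unfolding cube_eq_box K_def by (rule box_subset_cbox)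
    \<comment> \<open>Outside the index range the families are filled with zero, since the lemmas on
      segments ask for integrability at every index.\<close>
    have "\<exists>U. integrable lborel U \<and> (j \<in> ?J \<longrightarrow> (AE x in lborel. x \<in> K \<longrightarrow> U x = f j x))" for j
    proof (cases "j \<in> ?J")
      case True
      then have "L1_loc \<Omega> (f j)" using sob by (auto simp: W11_loc_def)
      from L1_loc_borel_representative[OF this K(1,2)] show ?thesis by metis
    qed (auto intro: exI[of _ "\<lambda>_. 0"])
    then obtain F where F: "\<And>j. integrable lborel (F j)"
      "\<And>j. j \<in> ?J \<Longrightarrow> AE x in lborel. x \<in> K \<longrightarrow> F j x = f j x"
      by metis
    have "\<exists>U. integrable lborel U \<and> (j \<in> ?J \<longrightarrow> (AE x in lborel. x \<in> K \<longrightarrow> U x = Df j k x))" for j k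
    proof (cases "j \<in> ?J")
      case True
      then have "L1_loc \<Omega> (Df j k)" using Dweak by (auto simp: weak_partial_def)
      from L1_loc_borel_representative[OF this K(1,2)] show ?thesis by metis
    qed (auto intro: exI[of _ "\<lambda>_. 0"])
    then obtain D where D: "\<And>j k. integrable lborel (D j k)"
      "\<And>j k. j \<in> ?J \<Longrightarrow> AE x in lborel. x \<in> K \<longrightarrow> D j k x = Df j k x"
      by metis
    have eqs: "AE x in lborel. \<forall>j\<in>?J. x \<in> K \<longrightarrow> F j x = f j x \<and> (\<forall>k. D j k x = Df j k x)"
    proof (rule AE_ball_countable')
      fix j assume j: "j \<in> ?J"
      have "AE x in lborel. \<forall>k. x \<in> K \<longrightarrow> D j k x = Df j k x"
        unfolding AE_all_countable using D(2)[OF j] by blast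
      with F(2)[OF j] show "AE x in lborel. x \<in> K \<longrightarrow> F j x = f j x \<and> (\<forall>k. D j k x = Df j k x)"
        by eventually_elim auto
    qed auto
    have seg: "AE y in lborel. y \<in> V \<longrightarrow> horizontal_segment n F (\<lambda>j. D j k) (axis k 1) h y"
      if h: "0 < h" "h \<le> r" for h k
    proof (rule AE_horizontal_segment[where K = K])
      show "AE y in lborel. y \<in> K \<longrightarrow> D (2*n+1) k y = (\<Sum>j=1..n. F j y * D (j+n) k y - F (j+n) y * D j k y)"
        using contact' eqs
      proof eventually_elim
        case (elim y)
        show ?case
        proof
          assume y: "y \<in> K"
          have eq: "F j y = f j y" "D j k y = Df j k y" if "j \<in> ?J" for j
            using elim(2) y that by blast+
          have "D (2*n+1) k y = (\<Sum>j=1..n. f j y * Df (j+n) k y - f (j+n) y * Df j k y)"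
            using elim(1) y K(2) eq by auto
          also have "\<dots> = (\<Sum>j=1..n. F j y * D (j+n) k y - F (j+n) y * D j k y)"
            using eq by (intro sum.cong refl) simp
          finally show "D (2*n+1) k y = \<dots>" .
        qed
      qed
      show "y + s *\<^sub>R axis k 1 \<in> K" if "y \<in> V" "0 \<le> s" "s \<le> h" for y s
      proof -
        have "y + s *\<^sub>R axis k 1 \<in> cube x0 (2 * r + 2 * r)"
          using that h unfolding V_def by (intro cube_add_axis) auto
        then show ?thesis using cubeK by (auto simp: r_def)
      qed
      fix j s assume j: "j \<in> ?J" and s: "0 \<le> s" "s \<le> h"
      show "AE y in lborel. y \<in> V \<longrightarrow> F j (y + s *\<^sub>R axis k 1) - F j y = indef_int (\<lambda>t. D j k (y + t *\<^sub>R axis k 1)) s"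
        unfolding V_def cube_eq_box indef_int_def
      proof (rule weak_partial_increment[OF _ F(1) D(1) F(2)[OF j] D(2)[OF j] s(1) _ K(2)])
        show "weak_partial \<Omega> (f j) k (Df j k)" using Dweak j by blast
        show "cbox (x0 - vec (2 * r)) (x0 + vec (2 * r) + s *\<^sub>R axis k 1) \<subseteq> K"
        proof
          fix y assume "y \<in> cbox (x0 - vec (2 * r)) (x0 + vec (2 * r) + s *\<^sub>R axis k 1)"
          then have y: "x0 $ i - 2 * r \<le> y $ i" "y $ i \<le> x0 $ i + 2 * r + s * axis k 1 $ i" for i
            by (auto simp: mem_box_cart)
          have "x0 $ i - R \<le> y $ i \<and> y $ i \<le> x0 $ i + R" for i
            using y[of i] s h R by (auto simp: r_def axis_def split: if_splits)
          then show "y \<in> K" by (simp add: K_def mem_box_cart)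
        qed
      qed
    qed (use F D Vm K h in auto)
    have WV: "x + h *\<^sub>R axis k 1 \<in> V" if "x \<in> W" "0 \<le> h" "h \<le> r" for x h k
      using cube_add_axis[of x x0 r h r k] that by (simp add: W_def V_def)
    have "AE x in lborel. \<forall>k l. x \<in> W \<longrightarrow> (\<Sum>j=1..n. D j k x * D (j+n) l x - D j l x * D (j+n) k x) = 0"
      unfolding AE_all_countable
      by (intro allI AE_horizontal_imp_isotropic[OF D(1) D(1) r seg seg] conjI WV)
    then have "AE x in lborel. x \<in> W \<longrightarrow> ?P x"
      using eqs
    proof eventually_elim
      case (elim x)
      show ?case
      proof (intro impI allI)
        fix k l assume x: "x \<in> W"
        have "x \<in> K"
          using x cubeK r cube_add_axis[of x x0 r 0 "3 * r"] unfolding W_def by (auto simp: r_def)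
        then have eq: "D j k x = Df j k x" if "j \<in> ?J" for j k
          using elim(2) that by blast
        have "(\<Sum>j=1..n. Df j k x * Df (j+n) l x - Df j l x * Df (j+n) k x)
          = (\<Sum>j=1..n. D j k x * D (j+n) l x - D j l x * D (j+n) k x)"
          using eq by (intro sum.cong refl) simp
        also have "\<dots> = 0" using elim(1) x by blast
        finally show "(\<Sum>j=1..n. Df j k x * Df (j+n) l x - Df j l x * Df (j+n) k x) = 0" .
      qed
    qed
    moreover have "open W" "x0 \<in> W" using r by (auto simp: W_def cube_eq_box open_box) (auto simp: mem_box_cart)
    ultimately show ?thesis by blast
  qed
  then have "\<forall>x0\<in>\<Omega>. \<exists>W. open W \<and> x0 \<in> W \<and> (AE x in lborel. x \<in> W \<longrightarrow> ?P x)"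
    by (rule ballI)
  from bchoice[OF this] obtain W where
    W: "\<forall>x0\<in>\<Omega>. open (W x0) \<and> x0 \<in> W x0 \<and> (AE x in lborel. x \<in> W x0 \<longrightarrow> ?P x)" ..
  \<comment> \<open>Countably many of the neighbourhoods already cover \<open>\<Omega>\<close>, so
    the union of their exceptional null sets is null.\<close>
  obtain \<F> where \<F>: "\<F> \<subseteq> W ` \<Omega>" "countable \<F>" "\<Union>\<F> = \<Union>(W ` \<Omega>)"
    using Lindelof[of "W ` \<Omega>"] W by blast
  have "AE y in lborel. \<forall>S\<in>\<F>. y \<in> S \<longrightarrow> ?P y"
  proof (rule AE_ball_countable')
    fix S assume "S \<in> \<F>"
    with \<F>(1) obtain x0 where "x0 \<in> \<Omega>" "S = W x0" by blast
    then show "AE y in lborel. y \<in> S \<longrightarrow> ?P y" using W by simp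
  qed (rule \<F>(2))
  then have "AE y in lborel. y \<in> \<Omega> \<longrightarrow> ?P y"
  proof eventually_elim
    case (elim y)
    show ?case
    proof
      assume "y \<in> \<Omega>"
      then have "y \<in> \<Union>\<F>" using W \<F>(3) by blast
      then show "?P y" using elim by blast
    qed
  qed
  then show ?thesis by (rule AE_completion)
qed

end
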